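(* Let $d\ge2$. The set $\mathcal{F}(\mathcal{P}^d_{ap})\subset\mathbb{Z}^d$ of $f$-vectors of the $d$-dimensional adapter polytopes, with the operation $x\boxplus y:=x+y-f(\Delta_d)$, forms an affine monoid. Moreover, the addition in this monoid is realized by $$f(P)\boxplus f(Q)=f(R)$$ for $P,Q\in\mathcal{P}^d_{ap}$, where $R=P'\cup Q$ (with $P'$ replaced by a projective image $\pi(P')$ if necessary) is obtained by adapter glueing of $P$ and $Q$.
   Context: A $d$-polytope is a $d$-dimensional convex polytope; $f(P)=(f_0(P),\dots,f_{d-1}(P))$, where $f_i(P)$ is the number of $i$-dimensional faces; $f(\Delta_d)$ is the $f$-vector of the $d$-simplex, $f_i(\Delta_d)=\binom{d+1}{i+1}$. A vertex of a $d$-polytope is simple if it lies in exactly $d$ facets (equivalently, exactly $d$ edges); a simplex facet is a facet that is a $(d-1)$-simplex. $\mathcal{P}^d_{ap}$, the class of adapter polytopes, consists of all $d$-polytopes $P$ that have a simple vertex $v$ contained in $d$ simplex facets of $P$, and an additional simplex facet $F$ that does not contain $v$. An affine monoid is a structure with neutral element that is isomorphic to a subset of some $\mathbb{Z}^n$ closed under addition. Adapter glueing of $P$ and $Q$: let $v$ be such a simple vertex of $P$ (contained in $d$ simplex facets), and let $F$ be such an additional simplex facet of $Q$ (not containing the distinguished simple vertex of $Q$). Let $P'$ be the convex hull of all vertices of $P$ other than $v$, and let $F'$ be the $(d-1)$-simplex spanned by the neighbors of $v$ in $P$, which is a facet of $P'$ (if $P$ is a $d$-simplex, then $P'=F'$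 is a $(d-1)$-simplex). Choose a projective transformation $\pi$ (not sending any point of $P'$ to infinity) such that $\pi(P')\cap Q=\pi(F')=F$, $\pi(P')\cup Q$ is convex, and all proper faces of $F$ are faces of $\pi(P')\cup Q$; then $R:=\pi(P')\cup Q$. *)

theory Defs
  imports "HOL-Analysis.Analysis" "HOL-Algebra.Product_Groups"
begin

section \<open>Affine monoids\<close>

abbreviation int_lattice :: "nat \<Rightarrow> (nat \<Rightarrow> int) monoid" where
  "int_lattice n \<equiv> product_group {..<n} (\<lambda>_. integer_group)"

text \<open>Finite generation is not part of this notion.  As \<open>M\<close> has a neutral element, the set \<open>S\<close>
  automatically contains the neutral element of the lattice.\<close>

definition affine_monoid :: "'b monoid \<Rightarrow> bool" where
  "affine_monoid M \<longleftrightarrow> monoid M \<and>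
     (\<exists>n S. S \<subseteq> carrier (int_lattice n) \<and>
            (\<forall>x\<in>S. \<forall>y\<in>S. x \<otimes>\<^bsub>int_lattice n\<^esub> y \<in> S) \<and>
            M \<cong> (int_lattice n)\<lparr>carrier := S\<rparr>)"


section \<open>Polytopes and \<open>f\<close>-vectors\<close>

text \<open>Throughout, \<open>d = DIM('a)\<close>, and \<open>d\<close>-polytopes are the full-dimensional ones in \<open>'a\<close>.\<close>

definition d_polytope :: "'a::euclidean_space set \<Rightarrow> bool" where
  "d_polytope P \<longleftrightarrow> polytope P \<and> aff_dim P = int DIM('a)"

definition f_vector :: "'a::euclidean_space set \<Rightarrow> nat \<Rightarrow> int" where
  "f_vector P = (\<lambda>i\<in>{..<DIM('a)}. int (card {G. G face_of P \<and> aff_dim G = int i}))"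

definition simplex_f_vector :: "nat \<Rightarrow> nat \<Rightarrow> int" where
  "simplex_f_vector d = (\<lambda>i\<in>{..<d}. int (Suc d choose Suc i))"

lemma f_vector_simplex:
  fixes S :: "'a::euclidean_space set"
  assumes "int DIM('a) simplex S"
  shows "f_vector S = simplex_f_vector DIM('a)"
proof -
  obtain C where C: "\<not> affine_dependent C" "int (card C) = int DIM('a) + 1" "S = convex hull C"
    using assms unfolding simplex_def by blast
  have fin: "finite C" using C(1) by (rule aff_independent_finite)
  have card: "card C = Suc DIM('a)" using C(2) by linarith
  have indep: "\<not> affine_dependent c" if "c \<subseteq> C" for c
    using that C(1) affine_dependent_subset by blast
  have ad: "aff_dim (convex hull c) = int (card c) - 1" if "c \<subseteq> C" for c
    using aff_dim_affine_independent [OF indep [OF that]] by (simp add: aff_dim_convex_hull)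
  have inj: "a = b" if "a \<subseteq> C" "b \<subseteq> C" "convex hull a = convex hull b" for a b
  proof -
    have "x \<in> a \<longleftrightarrow> x \<in> b" for x
      using extreme_point_of_convex_hull_affine_independent [OF indep [OF that(1)], of x]
        extreme_point_of_convex_hull_affine_independent [OF indep [OF that(2)], of x] that(3)
      by argo
    then show ?thesis by blast
  qed
  have "card {G. G face_of S \<and> aff_dim G = int i} = Suc DIM('a) choose Suc i" for i
  proof -
    have *: "aff_dim (convex hull c) = int i \<longleftrightarrow> card c = Suc i" if "c \<subseteq> C" for c
      using ad [OF that] by linarith
    have "{G. G face_of S \<and> aff_dim G = int i} = (hull) convex ` {c. c \<subseteq> C \<and> card c = Suc i}"
      unfolding C(3) face_of_convex_hull_affine_independent [OF C(1)] using * by blast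
    moreover have "inj_on ((hull) convex) {c. c \<subseteq> C \<and> card c = Suc i}"
      using inj by (intro inj_onI) blast
    moreover have "card {c. c \<subseteq> C \<and> card c = Suc i} = Suc DIM('a) choose Suc i"
      using n_subsets [OF fin, of "Suc i"] card by simp
    ultimately show ?thesis
      by (simp only: card_image)
  qed
  then show ?thesis
    by (simp only: f_vector_def simplex_f_vector_def)
qed

definition boxplus :: "nat \<Rightarrow> (nat \<Rightarrow> int) \<Rightarrow> (nat \<Rightarrow> int) \<Rightarrow> nat \<Rightarrow> int" where
  "boxplus d x y = (\<lambda>i\<in>{..<d}. x i + y i - simplex_f_vector d i)"


section \<open>Adapter polytopes\<close>

definition simple_vertex :: "'a::euclidean_space set \<Rightarrow> 'a \<Rightarrow> bool" where
  "simple_vertex P v \<longleftrightarrow> v extreme_point_of P \<and> card {G. G facet_of P \<and> v \<in> G} = DIM('a)"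

definition simplex_facet :: "'a::euclidean_space set \<Rightarrow> 'a set \<Rightarrow> bool" where
  "simplex_facet P F \<longleftrightarrow> F facet_of P \<and> (int DIM('a) - 1) simplex F"

definition adapter_pair :: "'a::euclidean_space set \<Rightarrow> 'a \<Rightarrow> 'a set \<Rightarrow> bool" where
  "adapter_pair P v F \<longleftrightarrow>
     simple_vertex P v \<and> card {G. simplex_facet P G \<and> v \<in> G} = DIM('a) \<and>
     simplex_facet P F \<and> v \<notin> F"

definition adapter_polytope :: "'a::euclidean_space set \<Rightarrow> bool" where
  "adapter_polytope P \<longleftrightarrow> d_polytope P \<and> (\<exists>v F. adapter_pair P v F)"

definition adapter_monoid :: "'a::euclidean_space itself \<Rightarrow> (nat \<Rightarrow> int) monoid" where
  "adapter_monoid _ =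
     \<lparr>carrier = {f_vector P |P :: 'a set. adapter_polytope P},
      monoid.mult = boxplus DIM('a),
      one = simplex_f_vector DIM('a)\<rparr>"


section \<open>Adapter glueing\<close>

text \<open>A projective transformation is given in homogeneous coordinates by a linear bijection \<open>L\<close> of
  \<open>'a \<times> real\<close>, a point \<open>x\<close> having coordinates \<open>(x, 1)\<close>.  It sends \<open>x\<close> to infinity iff the last
  coordinate of \<open>L (x, 1)\<close> vanishes.\<close>

definition proj_map :: "('a::euclidean_space \<times> real \<Rightarrow> 'a \<times> real) \<Rightarrow> 'a \<Rightarrow> 'a" where
  "proj_map L x = fst (L (x, 1)) /\<^sub>R snd (L (x, 1))"

definition projective_on ::
    "'a::euclidean_space set \<Rightarrow> ('a \<Rightarrow> 'a) \<Rightarrow> bool" where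
  "projective_on X \<pi> \<longleftrightarrow>
     (\<exists>L. linear L \<and> bij L \<and> (\<forall>x\<in>X. snd (L (x, 1)) \<noteq> 0 \<and> \<pi> x = proj_map L x))"

definition neighbors :: "'a::euclidean_space set \<Rightarrow> 'a \<Rightarrow> 'a set" where
  "neighbors P v = {w. w extreme_point_of P \<and> closed_segment v w edge_of P}"

definition remove_vertex :: "'a::euclidean_space set \<Rightarrow> 'a \<Rightarrow> 'a set" where
  "remove_vertex P v = convex hull ({w. w extreme_point_of P} - {v})"

definition vertex_base :: "'a::euclidean_space set \<Rightarrow> 'a \<Rightarrow> 'a set" where
  "vertex_base P v = convex hull (neighbors P v)"

text \<open>\<open>adapter_glueing P v Q F R\<close>: the set \<open>R\<close> arises by glueing \<open>P\<close>, with its vertex \<open>v\<close> removed,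
  onto the facet \<open>F\<close> of \<open>Q\<close>, for some admissible choice of the projective transformation.\<close>

definition adapter_glueing ::
    "'a::euclidean_space set \<Rightarrow> 'a \<Rightarrow> 'a set \<Rightarrow> 'a set \<Rightarrow> 'a set \<Rightarrow> bool" where
  "adapter_glueing P v Q F R \<longleftrightarrow>
     (\<exists>\<pi>. projective_on (remove_vertex P v) \<pi> \<and>
          \<pi> ` remove_vertex P v \<inter> Q = F \<and> \<pi> ` vertex_base P v = F \<and>
          R = \<pi> ` remove_vertex P v \<union> Q \<and> convex R \<and>
          (\<forall>K. K face_of F \<and> K \<noteq> F \<longrightarrow> K face_of R))"

end

(*
  A polytope P with an adapter vertex v is itself a glueing: the hyperplane through the neighbors of v
  cuts P into the simplex spanned by v and its neighbors, and P', and these meet in F'.  Whenever a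
  polytope is a convex union R of A and B that meet in a common facet F whose proper faces are faces of
  R, the proper faces of R are exactly those of A and of B, except F.  Applying this count both to P and
  to R, the contributions of P' (preserved by projective maps) and of F cancel, which gives the formula
  for f(R).

  For existence, P lies in the cone at v generated by the edges at v.  Choose z beyond the facet F of Q,
  but beneath all other facets.  The projective map with (u,1) -> (f u,1) on the neighbors u of v, where
  f is a bijection to the vertices of F, and (v,1) -> -(z,1), has nonnegative coefficients on the part of
  the cone beyond F', hence squeezes P' into the simplex spanned by z and F.
*)

theory Submission
  imports Defs
begin

section \<open>Projective transformations preserve convex hulls, faces, dimensions and
  simplices\<close>

section \<open>Projective maps\<close>

text \<open>Two obstacles shape the proof. A union along a facet can merge faces: two squares
  sharing an edge may form a rectangle, and then the endpoints of that edge are no longer vertices.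
  For R the definition of glueing excludes this. For P it has to be proved, and here the simplex
  facets at v enter: a proper face of F' misses some neighbor w, so it is a face of the facet
  spanned by v and the other neighbors. Secondly, a projective map respects convexity only where its
  denominator keeps its sign. The minus sign in (v,1) -> -(z,1) takes care of this: if h is the
  affine function that is 0 at v and 1 on the neighbors, the denominator is 2h - 1, so the
  hyperplane sent to infinity, h = 1/2, runs strictly between v and F'.

  If P is a simplex, P' drops in dimension and R = Q. Otherwise R inherits its adapter pair from
  both sides: the simple vertex is that of Q, which lies off F, and the additional facet is the
  image of that of P, which misses v and so survives the cut.\<close>

definition proj_dom :: "('a::euclidean_space \<times> real \<Rightarrow> 'a \<times> real) \<Rightarrow> 'a set" where
  "proj_dom L = {x. 0 < snd (L (x, 1))}"

lemma proj_dom_homogeneous: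
  assumes "x \<in> proj_dom L"
  shows "L (x, 1) = snd (L (x, 1)) *\<^sub>R (proj_map L x, 1)"
  using assms by (simp add: proj_dom_def proj_map_def prod_eq_iff)

lemma proj_mapI:
  assumes "L (x, 1) = s *\<^sub>R (y, 1)" "s > 0"
  shows "x \<in> proj_dom L" "proj_map L x = y"
  using assms by (simp_all add: proj_map_def proj_dom_def)

text \<open>The inverse M is carried along explicitly, so that facts about L also hold for M by
  interpretation. The contexts reopened below use this to get converse directions from direct
  ones.\<close>

locale projectivity =
  fixes L M :: "'a::euclidean_space \<times> real \<Rightarrow> 'a \<times> real"
  assumes linear_L: "linear L" and linear_M: "linear M"
    and M_L: "M (L p) = p" and L_M: "L (M p) = p"
begin

lemma inverse_projectivity: "projectivity M L"
  by (rule projectivity.intro) (rule linear_L linear_M M_L L_M)+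

lemma proj_map_inverse:
  assumes x: "x \<in> proj_dom L"
  shows "proj_map L x \<in> proj_dom M" "proj_map M (proj_map L x) = x"
proof -
  let ?s = "snd (L (x, 1))"
  have s: "?s > 0" using x by (simp add: proj_dom_def)
  have "(x, 1) = M (?s *\<^sub>R (proj_map L x, 1))"
    using proj_dom_homogeneous [OF x] M_L by metis
  also have "\<dots> = ?s *\<^sub>R M (proj_map L x, 1)"
    by (rule linear_cmul [OF linear_M])
  finally have "inverse ?s *\<^sub>R (x, 1) = (inverse ?s * ?s) *\<^sub>R M (proj_map L x, 1)"
    by (metis scaleR_scaleR)
  then have "M (proj_map L x, 1) = inverse ?s *\<^sub>R (x, 1)"
    using s by simp
  then show "proj_map L x \<in> proj_dom M" "proj_map M (proj_map L x) = x"
    using s by (auto intro: proj_mapI [where s = "inverse ?s"])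
qed

lemma inj_on_proj_map: "inj_on (proj_map L) (proj_dom L)"
  by (metis inj_onI proj_map_inverse(2))

text \<open>In homogeneous coordinates the map is linear. Dividing by the last coordinate s rescales
  the weight of b to c b * s(b) / s(x). Comparing last coordinates shows that the new weights sum to
  1, and they keep their sign because s is positive on \<open>proj_dom L\<close>.\<close>

lemma proj_map_affine_comb:
  assumes B: "finite B" "B \<subseteq> proj_dom L" and x: "x \<in> proj_dom L"
    and c: "sum c B = 1" "x = (\<Sum>b\<in>B. c b *\<^sub>R b)"
  obtains c' where "sum c' B = 1" "proj_map L x = (\<Sum>b\<in>B. c' b *\<^sub>R proj_map L b)"
    "\<And>b. b \<in> B \<Longrightarrow> 0 \<le> c b \<Longrightarrow> 0 \<le> c' b"
proof -
  let ?s = "\<lambda>x. snd (L (x, 1))"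
  define c' where "c' = (\<lambda>b. c b * ?s b / ?s x)"
  have sx: "?s x > 0" using x by (simp add: proj_dom_def)
  have "(x, 1::real) = (\<Sum>b\<in>B. c b *\<^sub>R (b, 1))"
    using c by (simp add: prod_eq_iff fst_sum snd_sum del: scaleR_Pair)
  then have "L (x, 1) = (\<Sum>b\<in>B. c b *\<^sub>R L (b, 1))"
    by (simp add: linear_sum [OF linear_L] linear_cmul [OF linear_L] del: scaleR_Pair)
  also have "\<dots> = (\<Sum>b\<in>B. (c b * ?s b) *\<^sub>R (proj_map L b, 1))"
    by (rule sum.cong, simp) (metis B(2) subsetD proj_dom_homogeneous scaleR_scaleR)
  finally have "inverse (?s x) *\<^sub>R L (x, 1) = (\<Sum>b\<in>B. c' b *\<^sub>R (proj_map L b, 1))"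
    by (simp add: scaleR_sum_right c'_def field_simps del: scaleR_Pair)
  moreover have "inverse (?s x) *\<^sub>R L (x, 1) = (inverse (?s x) * ?s x) *\<^sub>R (proj_map L x, 1)"
    by (metis proj_dom_homogeneous [OF x] scaleR_scaleR)
  ultimately have *: "(proj_map L x, 1::real) = (\<Sum>b\<in>B. c' b *\<^sub>R (proj_map L b, 1))"
    using sx by simp
  show thesis
  proof
    show "sum c' B = 1" using arg_cong [OF *, of snd] by (simp add: snd_sum)
    show "proj_map L x = (\<Sum>b\<in>B. c' b *\<^sub>R proj_map L b)"
      using arg_cong [OF *, of fst] by (simp add: fst_sum)
    show "0 \<le> c' b" if "b \<in> B" "0 \<le> c b" for b
    proof -
      have "0 < ?s b" using that B(2) by (auto simp: proj_dom_def)
      then show ?thesis using that sx by (simp add: c'_def)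
    qed
  qed
qed

lemma convex_proj_dom: "convex (proj_dom L)"
proof (rule convexI)
    fix x y and u v :: real
    assume xy: "x \<in> proj_dom L" "y \<in> proj_dom L" and uv: "0 \<le> u" "0 \<le> v" "u + v = 1"
    have "(u *\<^sub>R x + v *\<^sub>R y, 1) = u *\<^sub>R (x, 1) + v *\<^sub>R (y, 1::real)"
      using uv by (simp add: prod_eq_iff)
    then have "L (u *\<^sub>R x + v *\<^sub>R y, 1) = u *\<^sub>R L (x, 1) + v *\<^sub>R L (y, 1)"
      by (simp add: linear_add [OF linear_L] linear_cmul [OF linear_L] del: scaleR_Pair)
    then have "snd (L (u *\<^sub>R x + v *\<^sub>R y, 1)) = u * snd (L (x, 1)) + v * snd (L (y, 1))"
      by simp
    also have "\<dots> > 0" using xy uv unfolding proj_dom_def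
      by (smt (verit) mem_Collect_eq mult_nonneg_nonneg mult_pos_pos)
    finally show "u *\<^sub>R x + v *\<^sub>R y \<in> proj_dom L" by (simp add: proj_dom_def)
qed

lemma proj_map_in_convex_hull:
  assumes "S \<subseteq> proj_dom L" "x \<in> convex hull S"
  shows "proj_map L x \<in> convex hull (proj_map L ` S)"
proof -
  have xd: "x \<in> proj_dom L"
    using assms convex_proj_dom hull_minimal by blast
  obtain B c where B: "finite B" "B \<subseteq> S" "\<forall>b\<in>B. 0 \<le> c b" "sum c B = 1" "x = (\<Sum>b\<in>B. c b *\<^sub>R b)"
    using assms(2) unfolding convex_hull_explicit by blast
  then have "B \<subseteq> proj_dom L" using assms by auto
  then obtain c' where c': "sum c' B = 1" "proj_map L x = (\<Sum>b\<in>B. c' b *\<^sub>R proj_map L b)"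
    "\<And>b. b \<in> B \<Longrightarrow> 0 \<le> c b \<Longrightarrow> 0 \<le> c' b"
    using proj_map_affine_comb [OF B(1) _ xd B(4,5)] by metis
  have "(\<Sum>b\<in>B. c' b *\<^sub>R proj_map L b) \<in> convex hull (proj_map L ` S)"
    by (rule convex_sum) (use B c' in \<open>auto intro!: hull_inc\<close>)
  then show ?thesis using c'(2) by simp
qed

text \<open>Unlike a convex hull, the affine hull of S can leave \<open>proj_dom L\<close>, hence
  the separate assumption on x.\<close>

lemma proj_map_in_affine_hull:
  assumes "S \<subseteq> proj_dom L" "x \<in> proj_dom L" "x \<in> affine hull S"
  shows "proj_map L x \<in> affine hull (proj_map L ` S)"
proof -
  obtain B c where B: "finite B" "B \<subseteq> S" "sum c B = 1" "x = (\<Sum>b\<in>B. c b *\<^sub>R b)"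
    using assms(3) unfolding affine_hull_explicit by blast
  then have Bd: "B \<subseteq> proj_dom L" using assms by auto
  then obtain c' where c': "sum c' B = 1" "proj_map L x = (\<Sum>b\<in>B. c' b *\<^sub>R proj_map L b)"
    using proj_map_affine_comb [OF B(1) _ assms(2) B(3,4)] by metis
  \<comment> \<open>The weights are indexed by preimages; the inverse map moves them to the image
    points, where injectivity rules out collisions.\<close>
  define u where "u = c' \<circ> proj_map M"
  have inj: "inj_on (proj_map L) B" using inj_on_proj_map Bd inj_on_subset by blast
  have u: "u (proj_map L b) = c' b" if "b \<in> B" for b
    using proj_map_inverse(2) that Bd by (auto simp: u_def)
  have "sum u (proj_map L ` B) = 1" "(\<Sum>y\<in>proj_map L ` B. u y *\<^sub>R y) = proj_map L x"
    using c' u by (simp_all add: sum.reindex [OF inj])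
  then show ?thesis
    unfolding affine_hull_explicit
    by (rule_tac CollectI, rule_tac x="proj_map L ` B" in exI, rule_tac x=u in exI) (use B in auto)
qed

end

context projectivity begin

interpretation inv: projectivity M L by (rule inverse_projectivity)

lemma proj_map_convex_hull:
  assumes "S \<subseteq> proj_dom L"
  shows "proj_map L ` (convex hull S) = convex hull (proj_map L ` S)"
proof
  show "proj_map L ` (convex hull S) \<subseteq> convex hull (proj_map L ` S)"
    using proj_map_in_convex_hull assms by blast
  show "convex hull (proj_map L ` S) \<subseteq> proj_map L ` (convex hull S)"
  proof
    fix y assume y: "y \<in> convex hull (proj_map L ` S)"
    have SM: "proj_map L ` S \<subseteq> proj_dom M" using assms proj_map_inverse by auto
    have yd: "y \<in> proj_dom M" using SM y inv.convex_proj_dom hull_minimal by blast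
    have "proj_map M ` proj_map L ` S = S"
      using assms proj_map_inverse(2) by force
    then have "proj_map M y \<in> convex hull S"
      using inv.proj_map_in_convex_hull [OF SM y] by simp
    then show "y \<in> proj_map L ` (convex hull S)"
      using inv.proj_map_inverse(2) [OF yd] by (metis imageI)
  qed
qed

lemma convex_proj_map_image:
  assumes "X \<subseteq> proj_dom L" "convex X"
  shows "convex (proj_map L ` X)"
  by (metis assms convex_convex_hull hull_same proj_map_convex_hull)

lemma polytope_proj_map_image:
  assumes "X \<subseteq> proj_dom L" "polytope X"
  shows "polytope (proj_map L ` X)"
proof -
  obtain S where S: "finite S" "X = convex hull S" using assms unfolding polytope_def by blast
  then have "S \<subseteq> proj_dom L" using assms hull_subset [of S convex] by auto
  then have "proj_map L ` X = convex hull (proj_map L ` S)"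
    using proj_map_convex_hull S(2) by simp
  then show ?thesis using S(1) by (simp add: polytope_convex_hull)
qed

lemma proj_map_open_segment:
  assumes "x \<in> proj_dom L" "y \<in> proj_dom L" "p \<in> open_segment x y"
  shows "proj_map L p \<in> open_segment (proj_map L x) (proj_map L y)"
proof -
  have p: "p \<in> convex hull {x, y}" "p \<noteq> x" "p \<noteq> y"
    using assms(3) unfolding open_segment_def segment_convex_hull by blast+
  have pd: "p \<in> proj_dom L"
    using p(1) assms(1,2) convex_proj_dom hull_minimal [where S = convex and s = "{x, y}" and t = "proj_dom L"] by auto
  have "proj_map L p \<noteq> proj_map L x" "proj_map L p \<noteq> proj_map L y"
    using p(2,3) pd assms(1,2) by (metis proj_map_inverse(2))+
  moreover have "proj_map L p \<in> convex hull (proj_map L ` {x, y})"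
    by (rule proj_map_in_convex_hull) (use assms p in auto)
  ultimately show ?thesis
    by (simp add: open_segment_def segment_convex_hull)
qed

end

context projectivity begin

interpretation inv: projectivity M L by (rule inverse_projectivity)

text \<open>The inverse pulls an open segment of the image back to an open segment in X, so the
  defining property of a face is transported.\<close>

lemma face_of_proj_map_image:
  assumes X: "X \<subseteq> proj_dom L" and K: "K face_of X"
  shows "proj_map L ` K face_of proj_map L ` X"
  unfolding face_of_def
proof (intro conjI ballI impI)
  have "K \<subseteq> X" "convex K" using K by (auto simp: face_of_def)
  then show "proj_map L ` K \<subseteq> proj_map L ` X" "convex (proj_map L ` K)"
    using X convex_proj_map_image by auto
  fix a' b' p'
  assume "a' \<in> proj_map L ` X" "b' \<in> proj_map L ` X" "p' \<in> proj_map L ` K"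
    and seg: "p' \<in> open_segment a' b'"
  then obtain a b p where *: "a' = proj_map L a" "b' = proj_map L b" "p' = proj_map L p"
    "a \<in> X" "b \<in> X" "p \<in> K" by auto
  have "p \<in> open_segment a b"
    using inv.proj_map_open_segment [OF _ _ seg] * X \<open>K \<subseteq> X\<close> proj_map_inverse
    by (metis subsetD)
  then have "a \<in> K" "b \<in> K" using face_ofD [OF K] * by auto
  then show "a' \<in> proj_map L ` K" "b' \<in> proj_map L ` K" using * by auto
qed

text \<open>The image of an affine basis of X spans the image of X affinely and has no more
  elements. Equality comes from the same bound for the inverse map.\<close>

lemma aff_dim_proj_map_le:
  assumes X: "X \<subseteq> proj_dom L"
  shows "aff_dim (proj_map L ` X) \<le> aff_dim X"
proof -
  obtain B where B: "B \<subseteq> X" "\<not> affine_dependent B" "affine hull B = affine hull X"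
    using affine_basis_exists [of X] by metis
  have fB: "finite B" using B(2) aff_independent_finite by blast
  have "proj_map L ` X \<subseteq> affine hull (proj_map L ` B)"
  proof (rule image_subsetI)
    fix x assume "x \<in> X"
    then have "x \<in> affine hull B" unfolding B(3) by (rule hull_inc)
    then show "proj_map L x \<in> affine hull (proj_map L ` B)"
      using proj_map_in_affine_hull B(1) X \<open>x \<in> X\<close> by blast
  qed
  then have "aff_dim (proj_map L ` X) \<le> aff_dim (proj_map L ` B)"
    using aff_dim_subset aff_dim_affine_hull by metis
  also have "\<dots> \<le> int (card (proj_map L ` B)) - 1"
    using aff_dim_le_card fB by blast
  also have "\<dots> \<le> int (card B) - 1"
    using card_image_le [OF fB, of "proj_map L"] by linarith
  also have "\<dots> = aff_dim X"
    using aff_dim_affine_independent [OF B(2)] B(3) aff_dim_affine_hull [of B] aff_dim_affine_hull [of X]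
    by simp
  finally show ?thesis .
qed

end

context projectivity begin

interpretation inv: projectivity M L by (rule inverse_projectivity)

lemma proj_map_image_inverse:
  assumes "X \<subseteq> proj_dom L"
  shows "proj_map L ` X \<subseteq> proj_dom M" "proj_map M ` proj_map L ` X = X"
proof -
  show "proj_map L ` X \<subseteq> proj_dom M" using assms proj_map_inverse by auto
  have "\<And>x. x \<in> X \<Longrightarrow> proj_map M (proj_map L x) = x" using assms proj_map_inverse by auto
  then show "proj_map M ` proj_map L ` X = X" by (simp add: image_image)
qed

lemma aff_dim_proj_map:
  assumes X: "X \<subseteq> proj_dom L"
  shows "aff_dim (proj_map L ` X) = aff_dim X"
  using aff_dim_proj_map_le [OF X] inv.aff_dim_proj_map_le [of "proj_map L ` X"]
    proj_map_image_inverse [OF X] by auto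

text \<open>The image vertices are as many as before and span a set of the same dimension, which
  makes them affinely independent.\<close>

lemma simplex_proj_map:
  assumes X: "X \<subseteq> proj_dom L" and "n simplex X"
  shows "n simplex (proj_map L ` X)"
proof -
  obtain C where C: "\<not> affine_dependent C" "int (card C) = n + 1" "X = convex hull C"
    using assms(2) unfolding simplex_def by blast
  have fC: "finite C" using C(1) aff_independent_finite by blast
  have CX: "C \<subseteq> proj_dom L" using C(3) X hull_subset [of C convex] by auto
  have card: "card (proj_map L ` C) = card C"
    using inj_on_proj_map CX by (meson card_image inj_on_subset)
  have "aff_dim (proj_map L ` C) = int (card C) - 1"
    using aff_dim_proj_map [OF CX] aff_dim_affine_independent [OF C(1)] by simp
  then have "\<not> affine_dependent (proj_map L ` C)"
    by (simp add: affine_independent_iff_card card fC)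
  then show ?thesis
    using C card proj_map_convex_hull [OF CX] unfolding simplex_def by metis
qed

end

context projectivity begin

interpretation inv: projectivity M L by (rule inverse_projectivity)

lemma faces_proj_map:
  assumes X: "X \<subseteq> proj_dom L"
  shows "{K. K face_of proj_map L ` X \<and> aff_dim K = i} =
         (\<lambda>K. proj_map L ` K) ` {K. K face_of X \<and> aff_dim K = i}"
proof (intro equalityI subsetI)
  fix K assume K: "K \<in> {K. K face_of proj_map L ` X \<and> aff_dim K = i}"
  then have KM: "K \<subseteq> proj_dom M" using proj_map_image_inverse(1) [OF X] face_of_imp_subset by blast
  have "proj_map M ` K face_of X" "aff_dim (proj_map M ` K) = i"
    using K inv.face_of_proj_map_image [OF proj_map_image_inverse(1) [OF X], of K] inv.aff_dim_proj_map [OF KM]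
    by (auto simp: proj_map_image_inverse(2) [OF X])
  moreover have "K = proj_map L ` proj_map M ` K" using inv.proj_map_image_inverse(2) [OF KM] by simp
  ultimately show "K \<in> (\<lambda>K. proj_map L ` K) ` {K. K face_of X \<and> aff_dim K = i}" by blast
next
  fix K assume "K \<in> (\<lambda>K. proj_map L ` K) ` {K. K face_of X \<and> aff_dim K = i}"
  then obtain K' where K': "K = proj_map L ` K'" "K' face_of X" "aff_dim K' = i" by blast
  moreover have "K' \<subseteq> proj_dom L" using K' X face_of_imp_subset by blast
  ultimately show "K \<in> {K. K face_of proj_map L ` X \<and> aff_dim K = i}"
    using face_of_proj_map_image [OF X] aff_dim_proj_map by auto
qed

lemma card_faces_proj_map:
  assumes X: "X \<subseteq> proj_dom L"
  shows "card {K. K face_of proj_map L ` X \<and> aff_dim K = i} = card {K. K face_of X \<and> aff_dim K = i}"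
  unfolding faces_proj_map [OF X]
proof (rule card_image, rule inj_onI)
  fix K K' assume "K \<in> {K. K face_of X \<and> aff_dim K = i}" "K' \<in> {K. K face_of X \<and> aff_dim K = i}"
    and eq: "proj_map L ` K = proj_map L ` K'"
  then have "K \<subseteq> proj_dom L" "K' \<subseteq> proj_dom L" using X face_of_imp_subset by blast+
  then show "K = K'" using eq inj_on_proj_map by (meson inj_on_image_eq_iff)
qed

end

text \<open>A denominator that vanishes nowhere on a convex, hence connected, set has constant sign
  there. Since L and -L induce the same projective map, that sign may be taken positive.\<close>

lemma projective_on_convexD:
  fixes X :: "'a::euclidean_space set"
  assumes "projective_on X \<pi>" "convex X"
  obtains L M where "projectivity L M" "X \<subseteq> proj_dom L" "\<And>x. x \<in> X \<Longrightarrow> \<pi> x = proj_map L x"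
proof -
  obtain L where L: "linear L" "bij L" and ne: "\<And>x. x \<in> X \<Longrightarrow> snd (L (x, 1)) \<noteq> 0"
    and \<pi>: "\<And>x. x \<in> X \<Longrightarrow> \<pi> x = proj_map L x"
    using assms(1) unfolding projective_on_def by blast
  obtain M where M: "linear M" "\<And>x. M (L x) = x" "\<And>x. L (M x) = x"
    using linear_injective_isomorphism [OF L(1) bij_is_inj [OF L(2)]] by metis
  have pL: "projectivity L M" by (rule projectivity.intro) (rule L M)+
  have "linear (\<lambda>p. - L p)" "linear (\<lambda>p. M (- p))"
    using linear_compose_neg [OF L(1)] linear_compose_neg [OF M(1)] linear_neg [OF M(1)] by auto
  then have pN: "projectivity (\<lambda>p. - L p) (\<lambda>p. M (- p))"
    by (rule projectivity.intro) (simp_all add: M)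
  have cont: "continuous_on X (\<lambda>x. snd (L (x, 1)))"
    by (rule continuous_on_snd, rule linear_continuous_on_compose [OF _ L(1)])
       (intro continuous_on_Pair continuous_on_id continuous_on_const)
  have "connected ((\<lambda>x. snd (L (x, 1))) ` X)"
    using connected_continuous_image [OF cont] assms(2) convex_connected by blast
  moreover have "0 \<notin> (\<lambda>x. snd (L (x, 1))) ` X" using ne by force
  ultimately have "\<not> (\<exists>x\<in>X. \<exists>y\<in>X. snd (L (x, 1)) \<le> 0 \<and> 0 \<le> snd (L (y, 1)))"
    unfolding connected_iff_interval by blast
  then consider "\<forall>x\<in>X. snd (L (x, 1)) > 0" | "\<forall>x\<in>X. snd (L (x, 1)) < 0"
    by (meson linorder_not_le)
  then show thesis
  proof cases
    case 1
    show ?thesis by (rule that [OF pL]) (use 1 \<pi> in \<open>auto simp: proj_dom_def\<close>)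
  next
    case 2
    show ?thesis by (rule that [OF pN]) (use 2 \<pi> in \<open>auto simp: proj_dom_def proj_map_def\<close>)
  qed
qed

section \<open>Faces of a convex union of two polytopes along a common facet, and their
  number\<close>

section \<open>Convex unions along a common facet\<close>

abbreviation faces_dim :: "int \<Rightarrow> 'a::euclidean_space set \<Rightarrow> 'a set set" where
  "faces_dim i X \<equiv> {K. K face_of X \<and> aff_dim K = i}"

lemma d_polytope_facts:
  fixes P :: "'a::euclidean_space set"
  assumes "d_polytope P"
  shows "polytope P" "convex P" "closed P" "aff_dim P = int DIM('a)"
  using assms by (auto simp: d_polytope_def polytope_imp_convex polytope_imp_closed)

text \<open>Any other face would have a dimension strictly between two consecutive integers.\<close>

lemma face_containing_facet:
  assumes "convex A" "F facet_of A" "K face_of A" "F \<subseteq> K"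
  shows "K = F \<or> K = A"
proof (rule ccontr)
  assume *: "\<not> (K = F \<or> K = A)"
  have "F face_of K"
    using assms face_of_subset facet_of_imp_face_of face_of_imp_subset by blast
  then have "aff_dim F < aff_dim K"
    using * assms face_of_aff_dim_lt face_of_imp_convex by blast
  moreover have "aff_dim K < aff_dim A"
    using * assms face_of_aff_dim_lt by blast
  ultimately show False
    using assms(2) by (simp add: facet_of_def)
qed

text \<open>The roles of A and B are symmetric, so lemmas about faces are proved for A and
  transferred by \<open>swap\<close>.\<close>

locale face_glueing =
  fixes A B F R :: "'a::euclidean_space set"
  assumes A: "d_polytope A" and B: "d_polytope B"
    and FA: "F facet_of A" and FB: "F facet_of B"
    and A_Int_B: "A \<inter> B = F" and R_eq: "R = A \<union> B" and convex_R: "convex R"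
    and proper_faces: "\<And>K. K face_of F \<Longrightarrow> K \<noteq> F \<Longrightarrow> K face_of R"
begin

lemma swap: "face_glueing B A F R"
  using A B FA FB A_Int_B R_eq convex_R proper_faces by unfold_locales auto

text \<open>The closed sets A and B cover the connected segment and both meet it, so they meet each
  other on it.\<close>

lemma segment_meets:
  assumes "x \<in> A - F" "y \<in> B - F"
  obtains m where "m \<in> F" "m \<in> open_segment x y"
proof -
  have "closed_segment x y \<subseteq> A \<union> B"
    using assms convex_R R_eq by (simp add: closed_segment_subset)
  moreover have "A \<inter> closed_segment x y \<noteq> {}" "B \<inter> closed_segment x y \<noteq> {}"
    using assms by auto
  ultimately have "A \<inter> B \<inter> closed_segment x y \<noteq> {}"
    using connected_segment(1) [of x y] d_polytope_facts(3) [OF A] d_polytope_facts(3) [OF B]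
    unfolding connected_closed by blast
  then obtain m where "m \<in> F" "m \<in> closed_segment x y"
    using A_Int_B by blast
  moreover have "m \<noteq> x" "m \<noteq> y" using assms \<open>m \<in> F\<close> by auto
  ultimately show thesis using that by (simp add: open_segment_def)
qed

lemma F_neq: "F \<noteq> A" "F \<noteq> B"
  using FA FB by auto

lemma not_face_F: "\<not> F face_of R"
proof
  assume F: "F face_of R"
  obtain x y where xy: "x \<in> A - F" "y \<in> B - F"
    using F_neq FA FB facet_of_imp_subset by blast
  then obtain m where "m \<in> F" "m \<in> open_segment x y"
    using segment_meets by blast
  then show False using face_ofD [OF F] xy R_eq by blast
qed

text \<open>Suppose K has points x and y strictly on both sides; the segment between them crosses F
  at a point m of K. If K does not contain F, then \<open>K \<inter> F\<close> is a face of R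
  through m, which pulls x and y into F. If K contains F, then \<open>K \<inter> A\<close> is a face
  of A strictly larger than the facet F, hence all of A, against the bound on the dimension.\<close>

lemma face_of_R_subset:
  assumes K: "K face_of R" "aff_dim K < int DIM('a)"
  shows "K \<subseteq> A \<or> K \<subseteq> B"
proof (rule ccontr)
  assume "\<not> (K \<subseteq> A \<or> K \<subseteq> B)"
  then obtain x y where xy: "x \<in> K" "x \<in> A - F" "y \<in> K" "y \<in> B - F"
    using face_of_imp_subset [OF K(1)] R_eq A_Int_B by blast
  then obtain m where m: "m \<in> F" "m \<in> open_segment x y"
    using segment_meets by blast
  have conv: "convex F" using FA facet_of_imp_face_of face_of_imp_convex by blast
  have "m \<in> K"
    using m xy face_of_imp_convex [OF K(1)] convex_contains_open_segment by blast
  have "K \<inter> F face_of R \<inter> F"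
    using face_of_slice [OF K(1) conv] .
  moreover have "R \<inter> F = F" using A_Int_B R_eq by blast
  ultimately have "K \<inter> F = F \<or> K \<inter> F face_of R"
    using proper_faces by metis
  then show False
  proof
    assume "K \<inter> F face_of R"
    from face_ofD [OF this m(2)] show False using m \<open>m \<in> K\<close> xy R_eq by blast
  next
    assume "K \<inter> F = F"
    then have FK: "F \<subseteq> K \<inter> A" using FA facet_of_imp_subset by blast
    have "K \<inter> A face_of R \<inter> A"
      using face_of_slice [OF K(1)] d_polytope_facts(2) [OF A] by blast
    then have "K \<inter> A face_of A" using R_eq by (simp add: Int_absorb1)
    then have "K \<inter> A = F \<or> K \<inter> A = A"
      using face_containing_facet [OF d_polytope_facts(2) [OF A] FA _ FK] by blast
    moreover have "K \<inter> A \<noteq> F" using xy by blast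
    moreover have "K \<inter> A \<noteq> A"
      using K(2) d_polytope_facts(4) [OF A] aff_dim_subset [of A K] by auto
    ultimately show False by blast
  qed
qed

text \<open>For K not inside F, the trace \<open>K \<inter> F\<close> is a proper face of F and
  hence a face of R. It controls every segment that leaves A.\<close>

lemma face_of_left:
  assumes K: "K face_of A" "K \<noteq> F" "K \<noteq> A"
  shows "K face_of R"
proof (cases "K \<subseteq> F")
  case True
  then have "K face_of F"
    using K(1) FA face_of_subset facet_of_imp_subset by blast
  then show ?thesis using proper_faces K(2) by blast
next
  case nsub: False
  have conv: "convex F" using FA facet_of_imp_face_of face_of_imp_convex by blast
  have "K \<inter> F face_of A \<inter> F"
    using face_of_slice [OF K(1) conv] .
  moreover have "A \<inter> F = F" using A_Int_B by blast
  moreover have "K \<inter> F \<noteq> F"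
    using face_containing_facet [OF d_polytope_facts(2) [OF A] FA K(1)] K(2,3) by blast
  ultimately have KF: "K \<inter> F face_of R"
    using proper_faces by metis
  \<comment> \<open>This configuration is contradictory: whichever part of the segment contains p,
    either p or the crossing point m lies in \<open>K \<inter> F\<close>, and as this is a face of
    R, it would force b into F.\<close>
  have mixed: "a \<in> K \<and> b \<in> K"
    if ab: "a \<in> A - F" "b \<in> B - F" and p: "p \<in> K" "p \<in> open_segment a b" for a b p
  proof -
    have abR: "a \<in> R" "b \<in> R" using ab R_eq by auto
    obtain m where m: "m \<in> F" "m \<in> open_segment a b"
      using segment_meets [OF ab] .
    have mB: "m \<in> B" and mA: "m \<in> A" using m A_Int_B by auto
    have "p \<in> open_segment a m \<or> p = m \<or> p \<in> open_segment m b"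
      using p(2) m(2) Un_open_segment by blast
    then have "m \<in> K"
    proof (elim disjE)
      assume "p \<in> open_segment a m"
      then show ?thesis using face_ofD [OF K(1)] p(1) ab mA by blast
    next
      assume "p \<in> open_segment m b"
      then have "p \<in> B"
        using mB ab d_polytope_facts(2) [OF B] convex_contains_open_segment by blast
      then have "p \<in> K \<inter> F" using p(1) face_of_imp_subset [OF K(1)] A_Int_B by blast
      then have "b \<in> F" using face_ofD [OF KF p(2) abR] by blast
      then show ?thesis using ab by blast
    qed (use p in simp)
    then have "b \<in> F" using face_ofD [OF KF m(2) abR] m(1) by blast
    then show ?thesis using ab by blast
  qed
  show ?thesis
    unfolding face_of_def
  proof (intro conjI ballI impI)
    show "K \<subseteq> R" "convex K"
      using face_of_imp_subset [OF K(1)] R_eq face_of_imp_convex [OF K(1)] by auto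
    fix a b p assume ab: "a \<in> R" "b \<in> R" and p: "p \<in> K" "p \<in> open_segment a b"
    consider "a \<in> A" "b \<in> A" | "a \<in> B" "b \<in> B" | "a \<in> A - F" "b \<in> B - F" | "b \<in> A - F" "a \<in> B - F"
      using ab R_eq A_Int_B by blast
    then have "a \<in> K \<and> b \<in> K"
    proof cases
      case 1
      then show ?thesis using face_ofD [OF K(1) p(2)] p(1) by blast
    next
      case 2
      then have "p \<in> B"
        using p(2) d_polytope_facts(2) [OF B] convex_contains_open_segment by blast
      then have "p \<in> K \<inter> F" using p(1) face_of_imp_subset [OF K(1)] A_Int_B by blast
      then show ?thesis using face_ofD [OF KF p(2) ab] by blast
    next
      case 3
      then show ?thesis using mixed p by blast
    next
      case 4
      then show ?thesis using mixed [of b a p] p by (simp add: open_segment_commute)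
    qed
    then show "a \<in> K" "b \<in> K" by auto
  qed
qed

lemma face_of_R_iff:
  assumes "aff_dim K < int DIM('a)"
  shows "K face_of R \<longleftrightarrow> (K face_of A \<or> K face_of B) \<and> K \<noteq> F"
proof
  assume K: "K face_of R"
  then have "K face_of A \<or> K face_of B"
    using face_of_R_subset [OF K assms] face_of_subset R_eq by blast
  then show "(K face_of A \<or> K face_of B) \<and> K \<noteq> F"
    using not_face_F K by blast
next
  assume *: "(K face_of A \<or> K face_of B) \<and> K \<noteq> F"
  have "K \<noteq> A" "K \<noteq> B" using assms d_polytope_facts(4) [OF A] d_polytope_facts(4) [OF B] by auto
  then show "K face_of R"
    using * face_of_left face_glueing.face_of_left [OF swap] by blast
qed

lemma d_polytope_R: "d_polytope R"
proof -
  obtain S T where S: "finite S" "A = convex hull S" and T: "finite T" "B = convex hull T"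
    using A B unfolding d_polytope_def polytope_def by blast
  have "R = convex hull (S \<union> T)"
  proof
    have "convex hull S \<subseteq> convex hull (S \<union> T)" "convex hull T \<subseteq> convex hull (S \<union> T)"
      by (intro hull_mono, blast)+
    then show "R \<subseteq> convex hull (S \<union> T)" using R_eq S T by blast
    have "S \<subseteq> R" "T \<subseteq> R" using R_eq S T hull_subset [of S convex] hull_subset [of T convex] by auto
    then show "convex hull (S \<union> T) \<subseteq> R" using convex_R hull_minimal by (metis Un_least)
  qed
  moreover have "aff_dim R = int DIM('a)"
    using aff_dim_subset [of A R] aff_dim_le_DIM [of R] d_polytope_facts(4) [OF A] R_eq by auto
  ultimately show ?thesis
    using S T by (simp add: d_polytope_def polytope_convex_hull)
qed

lemma faces_dim_R:
  assumes "i < int DIM('a)"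
  shows "faces_dim i R = (faces_dim i A \<union> faces_dim i B) - {F}"
  using face_of_R_iff assms by auto

text \<open>Inclusion-exclusion: the faces common to A and B are exactly those of F. The last term
  removes F itself, which is a facet of both parts but not a face of R.\<close>

lemma card_faces_dim_R:
  assumes "i < int DIM('a)"
  shows "int (card (faces_dim i R)) =
    int (card (faces_dim i A)) + int (card (faces_dim i B)) - int (card (faces_dim i F))
     - (if i = int DIM('a) - 1 then 1 else 0)"
proof -
  have fin: "finite (faces_dim i A)" "finite (faces_dim i B)"
    using finite_polytope_faces A B
    by (auto simp: d_polytope_def intro: finite_subset [rotated])
  have int: "faces_dim i A \<inter> faces_dim i B = faces_dim i F"
  proof (intro equalityI subsetI)
    fix K assume "K \<in> faces_dim i A \<inter> faces_dim i B"
    moreover then have "K \<subseteq> F" using face_of_imp_subset A_Int_B by blast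
    ultimately show "K \<in> faces_dim i F"
      using face_of_subset facet_of_imp_subset [OF FA] by blast
  next
    fix K assume "K \<in> faces_dim i F"
    then show "K \<in> faces_dim i A \<inter> faces_dim i B"
      using face_of_trans FA FB facet_of_imp_face_of by blast
  qed
  have F_in: "F \<in> faces_dim i A \<union> faces_dim i B \<longleftrightarrow> i = int DIM('a) - 1"
    using FA FB d_polytope_facts(4) [OF A] d_polytope_facts(4) [OF B]
    by (auto simp: facet_of_def)
  have "card (faces_dim i A) + card (faces_dim i B) =
      card (faces_dim i A \<union> faces_dim i B) + card (faces_dim i F)"
    using card_Un_Int [OF fin] int by simp
  moreover have "int (card (faces_dim i R)) =
      int (card (faces_dim i A \<union> faces_dim i B)) - (if i = int DIM('a) - 1 then 1 else 0)"
  proof (cases "i = int DIM('a) - 1")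
    case True
    then have "F \<in> faces_dim i A \<union> faces_dim i B" using F_in by simp
    then have "card (faces_dim i A \<union> faces_dim i B) = Suc (card (faces_dim i A \<union> faces_dim i B - {F}))"
      using card.remove [OF finite_UnI [OF fin]] by blast
    then show ?thesis using True unfolding faces_dim_R [OF assms] by simp
  next
    case False
    then have "F \<notin> faces_dim i A \<union> faces_dim i B" using F_in by simp
    then have "faces_dim i A \<union> faces_dim i B - {F} = faces_dim i A \<union> faces_dim i B" by blast
    then show ?thesis using False unfolding faces_dim_R [OF assms] by simp
  qed
  ultimately show ?thesis by linarith
qed

end

section \<open>Coordinates for the cone at an adapter vertex\<close>

section \<open>The corner of a polytope at an adapter vertex\<close>

text \<open>Finitely many strict inequalities survive a small move in either direction. This serves
  for moving away from v without leaving the facets that miss v behind, and for placing the apex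
  beyond F.\<close>

lemma small_perturbation:
  fixes f g c :: "'b \<Rightarrow> real"
  assumes "finite N" "\<And>i. i \<in> N \<Longrightarrow> f i < c i"
  obtains t where "t > 0" "\<And>i s. i \<in> N \<Longrightarrow> \<bar>s\<bar> \<le> t \<Longrightarrow> f i + s * g i < c i"
proof -
  have "\<forall>\<^sub>F s in nhds 0. f i + s * g i < c i" if "i \<in> N" for i
  proof -
    have "((\<lambda>s. f i + s * g i) \<longlongrightarrow> f i + 0 * g i) (nhds 0)"
      by (intro tendsto_intros filterlim_ident)
    then show ?thesis using assms(2) [OF that] by (simp add: order_tendstoD)
  qed
  then have "\<forall>\<^sub>F s in nhds 0. \<forall>i\<in>N. f i + s * g i < c i"
    using assms(1) by (simp add: eventually_ball_finite)
  then obtain d where "d > 0" "\<And>s. dist s 0 < d \<Longrightarrow> \<forall>i\<in>N. f i + s * g i < c i"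
    unfolding eventually_nhds_metric by blast
  then show thesis by (intro that [of "d/2"]) auto
qed

text \<open>For the second part, walk from an interior point p to a point x outside P. The walk
  exits at a point y of some facet G; the inequality of G is strict at p and tight at y, so it fails
  at x.\<close>

lemma facet_halfspaces:
  fixes P :: "'a::euclidean_space set"
  assumes P: "d_polytope P"
  obtains a b where
    "\<And>G. G facet_of P \<Longrightarrow> P \<subseteq> {x. a G \<bullet> x \<le> b G} \<and> G = P \<inter> {x. a G \<bullet> x = b G}"
    "\<And>x. (\<And>G. G facet_of P \<Longrightarrow> a G \<bullet> x \<le> b G) \<Longrightarrow> x \<in> P"
proof -
  note P' = d_polytope_facts [OF P]
  have poly: "polyhedron P" using P'(1) by (rule polytope_imp_polyhedron)
  have "\<forall>G. \<exists>a b. G facet_of P \<longrightarrow> P \<subseteq> {x. a \<bullet> x \<le> b} \<and> G = P \<inter> {x. a \<bullet> x = b}"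
    using facet_of_polyhedron [OF poly] by metis
  then obtain a b where ab: "\<And>G. G facet_of P \<Longrightarrow> P \<subseteq> {x. a G \<bullet> x \<le> b G} \<and> G = P \<inter> {x. a G \<bullet> x = b G}"
    by metis
  have hull: "affine hull P = UNIV" using P'(4) by (simp add: aff_dim_eq_full)
  have rel: "rel_interior P = interior P" using hull by (rule rel_interior_interior)
  have "P \<noteq> {}" using P'(4) by auto
  then obtain p where p: "p \<in> interior P"
    using rel_interior_eq_empty [OF P'(2)] rel by auto
  then have pP: "p \<in> P" using interior_subset by blast
  show thesis
  proof (rule that [OF ab])
    fix x assume x: "\<And>G. G facet_of P \<Longrightarrow> a G \<bullet> x \<le> b G"
    show "x \<in> P"
    proof (rule ccontr)
      assume xP: "x \<notin> P"
      have "closed_segment p x \<inter> frontier P \<noteq> {}"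
        by (rule connected_Int_frontier) (use pP xP in auto)
      then obtain y where y: "y \<in> closed_segment p x" "y \<in> frontier P" by blast
      then have yP: "y \<in> P - rel_interior P"
        using P'(3) rel by (simp add: frontier_def)
      then obtain G where G: "G facet_of P" "y \<in> G"
        using rel_boundary_of_polyhedron [OF poly] by blast
      have "p \<notin> G"
        using face_of_disjoint_interior [OF facet_of_imp_face_of [OF G(1)]] p G(1) facet_of_irrefl
        by blast
      then have "a G \<bullet> p < b G" using ab [OF G(1)] pP by fastforce
      moreover have "a G \<bullet> y = b G" using ab [OF G(1)] G(2) by blast
      moreover obtain u where u: "0 \<le> u" "u \<le> 1" "y = (1 - u) *\<^sub>R p + u *\<^sub>R x"
        using y(1) by (auto simp: in_segment)
      moreover have "u \<noteq> 1" using u yP xP by auto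
      ultimately have "(1 - u) * (a G \<bullet> p) + u * (a G \<bullet> x) = b G" "(1 - u) * (a G \<bullet> p) < (1 - u) * b G"
        by (auto simp: inner_add_right)
      moreover have "u * (a G \<bullet> x) \<le> u * b G" using x [OF G(1)] u by (simp add: mult_left_mono)
      ultimately show False by (simp add: algebra_simps)
    qed
  qed
qed

text \<open>The weight missing to 1 goes to v.\<close>

lemma convex_hull_insert_cone:
  assumes "finite U" "\<And>w. w \<in> U \<Longrightarrow> 0 \<le> c w" "sum c U \<le> 1"
  shows "v + (\<Sum>w\<in>U. c w *\<^sub>R (w - v)) \<in> convex hull (insert v U)"
proof (cases "sum c U = 0")
  case True
  then have "\<And>w. w \<in> U \<Longrightarrow> c w = 0" using assms sum_nonneg_eq_0_iff by blast
  then show ?thesis by (simp add: hull_inc)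
next
  case False
  then have pos: "sum c U > 0" using assms by (simp add: sum_nonneg order_less_le)
  define y where "y = (\<Sum>w\<in>U. (c w / sum c U) *\<^sub>R w)"
  have "y \<in> convex hull (insert v U)" unfolding y_def
    by (rule convex_sum) (use assms pos in \<open>auto simp: hull_inc simp flip: sum_divide_distrib\<close>)
  moreover have "v \<in> convex hull (insert v U)" by (simp add: hull_inc)
  ultimately have "(1 - sum c U) *\<^sub>R v + sum c U *\<^sub>R y \<in> convex hull (insert v U)"
    using assms(3) pos by (intro convexD) auto
  moreover have "sum c U *\<^sub>R y = (\<Sum>w\<in>U. c w *\<^sub>R w)"
    using False by (simp add: y_def scaleR_sum_right)
  ultimately show ?thesis
    by (simp add: algebra_simps sum_subtractf flip: scaleR_sum_left)
qed

text \<open>The vectors w - v form a basis and the \<alpha> w are its dual linear forms, so the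
  numbers \<open>\<alpha> w \<bullet> (x - v)\<close> are the coordinates of x in the cone at v.
  That U is the set of neighbors is derived later, in \<open>neighbors_eq\<close>. The simplex
  facets at v are recorded in \<open>facet_faces\<close>.\<close>

locale adapter_frame =
  fixes P :: "'a::euclidean_space set" and v :: 'a and U :: "'a set" and \<alpha> :: "'a \<Rightarrow> 'a"
  assumes P: "d_polytope P" and v_ext: "v extreme_point_of P"
    and finU: "finite U" and cardU: "card U = DIM('a)" and vU: "v \<notin> U"
    and U_ext: "\<And>w. w \<in> U \<Longrightarrow> w extreme_point_of P"
    and dual: "\<And>w w'. w \<in> U \<Longrightarrow> w' \<in> U \<Longrightarrow> \<alpha> w \<bullet> (w' - v) = (if w' = w then 1 else 0)"
    and nonneg: "\<And>x w. x \<in> P \<Longrightarrow> w \<in> U \<Longrightarrow> 0 \<le> \<alpha> w \<bullet> (x - v)"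
    and expand: "\<And>x. x = v + (\<Sum>w\<in>U. (\<alpha> w \<bullet> (x - v)) *\<^sub>R (w - v))"
    and facet_faces: "\<And>w. w \<in> U \<Longrightarrow> convex hull (insert v (U - {w})) face_of P"
    and edges: "\<And>w. w \<in> U \<Longrightarrow> closed_segment v w face_of P"
begin

text \<open>By \<open>expand\<close>, the vectors w - v span the space, and there are only d of
  them.\<close>

lemma affine_independent: "\<not> affine_dependent (insert v U)"
proof -
  let ?B = "(\<lambda>x. - v + x) ` U"
  have "x \<in> span ?B" for x
  proof -
    have "x = (\<Sum>w\<in>U. (\<alpha> w \<bullet> x) *\<^sub>R (w - v))"
      using expand [of "v + x"] by simp
    moreover have "\<dots> \<in> span ?B"
      by (intro span_sum span_scale span_base) auto
    ultimately show ?thesis by simp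
  qed
  moreover have "card ?B = DIM('a)" using cardU by (simp add: card_image)
  ultimately have "independent ?B"
    using card_le_dim_spanning [of ?B UNIV] finU by (simp add: subset_iff)
  then show ?thesis using affine_dependent_iff_dependent [OF vU] by simp
qed

lemma vP: "v \<in> P" and UP: "U \<subseteq> P"
  using v_ext U_ext by (auto simp: extreme_point_of_def)

text \<open>For the harder inclusion, the edge from v to w is intersected with the simplex spanned
  by v and U. The result is a face of that simplex with a point other than v, so it contains some u
  in U; being extreme in P, u can only be the end w.\<close>

lemma neighbors_eq: "neighbors P v = U"
proof (intro equalityI subsetI)
  fix w assume w: "w \<in> U"
  then have "v \<noteq> w" using vU by blast
  then have "aff_dim (closed_segment v w) = 1"
    by (simp add: segment_convex_hull aff_dim_convex_hull aff_dim_2)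
  then show "w \<in> neighbors P v"
    using w U_ext edges by (simp add: neighbors_def edge_of_def)
next
  fix w assume "w \<in> neighbors P v"
  then have w: "w extreme_point_of P" "closed_segment v w face_of P" "aff_dim (closed_segment v w) = 1"
    by (auto simp: neighbors_def edge_of_def)
  have "v \<noteq> w" using w(3) by auto
  let ?S = "convex hull (insert v U)"
  let ?c = "\<lambda>u. \<alpha> u \<bullet> (w - v)"
  have wP: "w \<in> P" using w(1) by (simp add: extreme_point_of_def)
  have c0: "sum ?c U \<ge> 0" using nonneg wP by (simp add: sum_nonneg)
  \<comment> \<open>Chosen so that the coordinates of y, which are \<delta> times those of w, sum to
    at most 1. Then y lies in the simplex.\<close>
  define \<delta> where "\<delta> = 1 / (1 + sum ?c U)"
  have \<delta>: "\<delta> > 0" "\<delta> \<le> 1" "\<delta> * sum ?c U \<le> 1" using c0 by (auto simp: \<delta>_def divide_simps)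
  define y where "y = v + (\<Sum>u\<in>U. (\<delta> * ?c u) *\<^sub>R (u - v))"
  have yS: "y \<in> ?S" unfolding y_def
    by (rule convex_hull_insert_cone)
       (use finU \<delta> nonneg wP in \<open>auto simp flip: sum_distrib_left\<close>)
  have yw: "y = v + \<delta> *\<^sub>R (w - v)"
    using arg_cong [OF expand [of w], of "\<lambda>x. v + \<delta> *\<^sub>R (x - v)"] by (simp add: y_def scaleR_sum_right)
  then have y: "y \<in> closed_segment v w" "y \<noteq> v"
    using \<delta> \<open>v \<noteq> w\<close> by (auto simp: in_segment algebra_simps intro!: exI [of _ \<delta>])
  have SP: "?S \<subseteq> P" using d_polytope_facts(2) [OF P] vP UP by (simp add: hull_minimal)
  have "closed_segment v w \<inter> ?S face_of P \<inter> ?S"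
    by (rule face_of_slice [OF w(2)]) simp
  then have "closed_segment v w \<inter> ?S face_of ?S" using SP by (simp add: Int_absorb1)
  then obtain C where C: "C \<subseteq> insert v U" "closed_segment v w \<inter> ?S = convex hull C"
    using face_of_convex_hull_affine_independent [OF affine_independent] by blast
  have "\<not> C \<subseteq> {v}"
  proof
    assume "C \<subseteq> {v}"
    then have "convex hull C \<subseteq> convex hull {v}" by (rule hull_mono)
    then show False using C y yS by auto
  qed
  then obtain u where u: "u \<in> C" "u \<in> U" using C(1) by blast
  then have "u \<in> closed_segment v w" using C(2) hull_inc [of u C convex] by blast
  moreover have "u \<notin> open_segment v w"
    using U_ext [OF u(2)] vP wP by (simp add: extreme_point_of_def)
  moreover have "u \<noteq> v" using u vU by blast
  ultimately have "u = w" by (auto simp: open_segment_def)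
  then show "w \<in> U" using u by blast
qed

end

text \<open>The normals of the d facets at v have a dual system of directions e G. Leaving out G,
  the remaining facets at v intersect in the edge \<open>E G\<close> with direction e G, whose far
  end \<open>u G\<close> becomes the element of U associated with G.\<close>

lemma adapter_frame_exists:
  fixes P :: "'a::euclidean_space set"
  assumes P: "d_polytope P" and v: "simple_vertex P v"
    and simplices: "card {G. simplex_facet P G \<and> v \<in> G} = DIM('a)"
  obtains U \<alpha> where "adapter_frame P v U \<alpha>"
proof -
  note P' = d_polytope_facts [OF P]
  define N where "N = {G. G facet_of P \<and> v \<in> G}"
  have vext: "v extreme_point_of P" and cardN: "card N = DIM('a)"
    using v by (auto simp: simple_vertex_def N_def)
  have vP: "v \<in> P" using vext by (simp add: extreme_point_of_def)
  have finN: "finite N" using cardN card.infinite by fastforce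
  \<comment> \<open>Both sets of facets have d elements, so every facet at v is a simplex.\<close>
  have "{G. simplex_facet P G \<and> v \<in> G} = N"
    by (rule card_subset_eq [OF finN]) (use simplices cardN in \<open>auto simp: N_def simplex_facet_def\<close>)
  then have simplexN: "(int DIM('a) - 1) simplex G" if "G \<in> N" for G
    using that by (auto simp: simplex_facet_def)
  obtain a b where
    ab: "\<And>G. G facet_of P \<Longrightarrow> P \<subseteq> {x. a G \<bullet> x \<le> b G} \<and> G = P \<inter> {x. a G \<bullet> x = b G}"
    and inP: "\<And>x. (\<And>G. G facet_of P \<Longrightarrow> a G \<bullet> x \<le> b G) \<Longrightarrow> x \<in> P"
    by (rule facet_halfspaces [OF P]) blast
  have N_eq: "G = P \<inter> {x. a G \<bullet> x = b G}" "\<And>x. x \<in> P \<Longrightarrow> a G \<bullet> x \<le> b G" "a G \<bullet> v = b G" "G face_of P"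
    if "G \<in> N" for G
    using ab [of G] that facet_of_imp_face_of by (auto simp: N_def)
  define M where "M = {G. G facet_of P \<and> v \<notin> G}"
  have finM: "finite M"
    using finite_polytope_facets [OF P'(1)] by (auto simp: M_def intro: finite_subset [rotated])
  have M_less: "a G \<bullet> v < b G" if "G \<in> M" for G
    using ab [of G] that vP by (fastforce simp: M_def)
  have facet_cases: "G \<in> N \<or> G \<in> M" if "G facet_of P" for G
    using that by (auto simp: N_def M_def)
  have near_v: "\<exists>t>0. \<forall>s. \<bar>s\<bar> \<le> t \<longrightarrow> (\<forall>G\<in>M. a G \<bullet> (v + s *\<^sub>R x) < b G)" for x
  proof -
    obtain t where "t > 0" "\<And>G s. G \<in> M \<Longrightarrow> \<bar>s\<bar> \<le> t \<Longrightarrow> a G \<bullet> v + s * (a G \<bullet> x) < b G"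
      using small_perturbation [OF finM, of "\<lambda>G. a G \<bullet> v" b "\<lambda>G. a G \<bullet> x"] M_less by blast
    then show ?thesis by (auto simp: inner_add_right)
  qed
  \<comment> \<open>A direction in the kernel of all normals at v could be followed a little both
    ways inside P, so v would not be extreme.\<close>
  have zero: "x = 0" if x: "\<And>G. G \<in> N \<Longrightarrow> a G \<bullet> x = 0" for x
  proof (rule ccontr)
    assume "x \<noteq> 0"
    obtain t where t: "t > 0" "\<And>s G. \<bar>s\<bar> \<le> t \<Longrightarrow> G \<in> M \<Longrightarrow> a G \<bullet> (v + s *\<^sub>R x) < b G"
      using near_v [of x] by blast
    have sP: "v + s *\<^sub>R x \<in> P" if "\<bar>s\<bar> \<le> t" for s
    proof (rule inP)
      fix G assume "G facet_of P"
      then consider "G \<in> N" | "G \<in> M" using facet_cases by blast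
      then show "a G \<bullet> (v + s *\<^sub>R x) \<le> b G"
        by cases (use that x N_eq(3) t in \<open>auto simp: inner_add_right less_imp_le\<close>)
    qed
    have "v - t *\<^sub>R x \<in> P" "v + t *\<^sub>R x \<in> P" using sP [of "- t"] sP [of t] t(1) by auto
    moreover have "v \<in> open_segment (v - t *\<^sub>R x) (v + t *\<^sub>R x)"
      unfolding in_segment using t(1) \<open>x \<noteq> 0\<close>
      by (auto intro!: exI [of _ "1/2"] simp: algebra_simps eq_neg_iff_add_eq_0 simp flip: scaleR_add_left)
    ultimately show False using vext by (auto simp: extreme_point_of_def)
  qed
  \<comment> \<open>A nonzero vector orthogonal to the other d - 1 normals exists by dimension. The
    value -1 makes it point into the half-space of G.\<close>
  have "\<exists>e. a G \<bullet> e = -1 \<and> (\<forall>H\<in>N - {G}. a H \<bullet> e = 0)" if G: "G \<in> N" for G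
  proof -
    have "card (a ` (N - {G})) < DIM('a)"
      using card_image_le [of "N - {G}" a] finN cardN card_Diff1_less [OF finN G] by simp
    then have "dim (a ` (N - {G})) < DIM('a)"
      using dim_le_card' [of "a ` (N - {G})"] finN by simp
    then have "span (a ` (N - {G})) \<noteq> UNIV"
      by (metis dim_span dim_UNIV less_irrefl)
    then obtain e where e: "e \<noteq> 0" "\<And>x. x \<in> span (a ` (N - {G})) \<Longrightarrow> e \<bullet> x = 0"
      using span_not_UNIV_orthogonal by blast
    have e0: "a H \<bullet> e = 0" if "H \<in> N - {G}" for H
      using e(2) [of "a H"] that by (simp add: span_base inner_commute)
    then have "a G \<bullet> e \<noteq> 0" using zero [of e] e(1) by blast
    then show ?thesis
      using e0 by (intro exI [of _ "(- 1 / (a G \<bullet> e)) *\<^sub>R e"]) auto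
  qed
  then obtain e where e: "\<And>G. G \<in> N \<Longrightarrow> a G \<bullet> e G = -1"
    "\<And>G H. G \<in> N \<Longrightarrow> H \<in> N \<Longrightarrow> H \<noteq> G \<Longrightarrow> a H \<bullet> e G = 0"
    by (metis DiffI singletonD)
  have ae: "a H \<bullet> e G = (if G = H then - 1 else 0)" if "G \<in> N" "H \<in> N" for G H
    using e that by auto
  have expand: "x - v = (\<Sum>G\<in>N. (b G - a G \<bullet> x) *\<^sub>R e G)" for x
  proof -
    have "a H \<bullet> (x - v - (\<Sum>G\<in>N. (b G - a G \<bullet> x) *\<^sub>R e G)) = 0" if H: "H \<in> N" for H
    proof -
      have "(\<Sum>G\<in>N. (b G - a G \<bullet> x) * (a H \<bullet> e G)) = (\<Sum>G\<in>N. if G = H then a H \<bullet> x - b H else 0)"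
        by (rule sum.cong) (use ae H in auto)
      then show ?thesis
        using finN H N_eq(3) [OF H] by (simp add: inner_diff_right inner_sum_right)
    qed
    from zero [OF this] show ?thesis by simp
  qed
  \<comment> \<open>Inserting P keeps the intersection inside P also when N has no other
    member.\<close>
  define E where "E G = \<Inter> (insert P (N - {G}))" for G
  have E_face: "E G face_of P" for G
    unfolding E_def by (rule face_of_Inter) (use N_eq(4) P'(2) face_of_refl in auto)
  have E_iff: "x \<in> E G \<longleftrightarrow> x \<in> P \<and> (\<forall>H\<in>N - {G}. a H \<bullet> x = b H)" for x G
    using N_eq(1) by (auto simp: E_def)
  have vE: "v \<in> E G" for G using E_iff vP N_eq(3) by auto
  have E_ray: "x - v = (b G - a G \<bullet> x) *\<^sub>R e G" if "G \<in> N" "x \<in> E G" for x G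
  proof -
    have "(\<Sum>H\<in>N. (b H - a H \<bullet> x) *\<^sub>R e H) = (\<Sum>H\<in>N. if H = G then (b G - a G \<bullet> x) *\<^sub>R e G else 0)"
      by (rule sum.cong) (use that E_iff in auto)
    then show ?thesis using expand [of x] that(1) finN by simp
  qed
  \<comment> \<open>The slack in the inequality of G measures the distance from v along the edge in
    multiples of e G; its maximum, attained by compactness, marks the far end.\<close>
  have "\<exists>u\<in>E G. (\<forall>x\<in>E G. b G - a G \<bullet> x \<le> b G - a G \<bullet> u)" for G
  proof (rule continuous_attains_sup)
    show "compact (E G)" "E G \<noteq> {}" "continuous_on (E G) (\<lambda>x. b G - a G \<bullet> x)"
      using face_of_imp_compact [OF P'(2) polytope_imp_compact [OF P'(1)] E_face] vE
      by (auto intro!: continuous_intros)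
  qed
  then obtain u where uE: "\<And>G. u G \<in> E G" and umax: "\<And>G x. x \<in> E G \<Longrightarrow> b G - a G \<bullet> x \<le> b G - a G \<bullet> u G"
    by metis
  define t where "t G = b G - a G \<bullet> u G" for G
  have tpos: "t G > 0" if G: "G \<in> N" for G
  proof -
    obtain r where r: "r > 0" "\<And>s H. \<bar>s\<bar> \<le> r \<Longrightarrow> H \<in> M \<Longrightarrow> a H \<bullet> (v + s *\<^sub>R e G) < b H"
      using near_v [of "e G"] by blast
    have "v + r *\<^sub>R e G \<in> P"
    proof (rule inP)
      fix H assume "H facet_of P"
      then consider "H \<in> N" | "H \<in> M" using facet_cases by blast
      then show "a H \<bullet> (v + r *\<^sub>R e G) \<le> b H"
        by cases (use r ae [OF G] N_eq(3) in \<open>auto simp: inner_add_right less_imp_le\<close>)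
    qed
    then have "v + r *\<^sub>R e G \<in> E G"
      unfolding E_iff using ae [OF G] N_eq(3) by (auto simp: inner_add_right)
    from umax [OF this] show ?thesis
      using r(1) ae [OF G G] N_eq(3) [OF G] by (simp add: t_def inner_add_right)
  qed
  have u_eq: "u G - v = t G *\<^sub>R e G" if "G \<in> N" for G
    using E_ray [OF that uE] unfolding t_def .
  have au: "a H \<bullet> u G = (if G = H then b H - t H else b H)" if "G \<in> N" "H \<in> N" for G H
    using uE [of G] E_iff that by (auto simp: t_def)
  have uP: "u G \<in> P" for G using uE E_iff by blast
  have E_segment: "E G = closed_segment v (u G)" if G: "G \<in> N" for G
  proof
    show "closed_segment v (u G) \<subseteq> E G"
      using vE uE face_of_imp_convex [OF E_face] by (simp add: closed_segment_subset)
    show "E G \<subseteq> closed_segment v (u G)"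
    proof
      fix x assume x: "x \<in> E G"
      let ?s = "(b G - a G \<bullet> x) / t G"
      have "0 \<le> ?s" "?s \<le> 1"
        using x umax [OF x] tpos [OF G] E_iff N_eq(2) [OF G] by (auto simp: t_def)
      moreover have "x - v = ?s *\<^sub>R (u G - v)"
        using E_ray [OF G x] u_eq [OF G] tpos [OF G] by simp
      then have "x = (1 - ?s) *\<^sub>R v + ?s *\<^sub>R u G" by (simp add: algebra_simps)
      ultimately show "x \<in> closed_segment v (u G)" unfolding in_segment by blast
    qed
  qed
  have u_ext: "u G extreme_point_of P" if "G \<in> N" for G
    using extreme_point_of_face [OF E_face [of G]] E_segment [OF that] extreme_point_of_segment by metis
  have u_neq: "u G \<noteq> v" if "G \<in> N" for G
    using au [OF that that] N_eq(3) [OF that] tpos [OF that] by auto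
  have inj_u: "inj_on u N"
  proof (rule inj_onI, rule ccontr)
    fix G H assume GH: "G \<in> N" "H \<in> N" "u G = u H" "G \<noteq> H"
    then show False using au [of G G] au [of H G] tpos [of G] by simp
  qed
  \<comment> \<open>As a simplex, G has exactly d vertices. The points v and u H for H other than G
    are d distinct vertices of P lying in G, so they are all of them.\<close>
  have facet_hull: "G = convex hull (insert v (u ` (N - {G})))" if G: "G \<in> N" for G
  proof -
    obtain C where C: "\<not> affine_dependent C" "int (card C) = int DIM('a) - 1 + 1" "G = convex hull C"
      using simplexN [OF G] unfolding simplex_def by blast
    have ext: "x \<in> C" if "x \<in> G" "x extreme_point_of P" for x
      using that extreme_point_of_face [OF N_eq(4) [OF G]] extreme_point_of_convex_hull_affine_independent [OF C(1)]
        C(3) by simp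
    have sub: "insert v (u ` (N - {G})) \<subseteq> C"
    proof
      fix x assume "x \<in> insert v (u ` (N - {G}))"
      then consider "x = v" | H where "H \<in> N" "H \<noteq> G" "x = u H" by blast
      then show "x \<in> C"
      proof cases
        case 1
        then show ?thesis using ext vext G by (simp add: N_def)
      next
        case 2
        then have "x \<in> G" using N_eq(1) [OF G] uP au [OF 2(1) G] by auto
        then show ?thesis using ext u_ext 2 by blast
      qed
    qed
    have "card (u ` (N - {G})) = DIM('a) - 1"
      using card_image [OF inj_on_subset [OF inj_u]] cardN finN G by (metis Diff_subset card_Diff_singleton)
    moreover have "v \<notin> u ` (N - {G})" using u_neq by auto
    ultimately have "card (insert v (u ` (N - {G}))) = card C"
      using C(2) finN by simp
    then have "insert v (u ` (N - {G})) = C"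
      using card_subset_eq [OF aff_independent_finite [OF C(1)] sub] by blast
    then show ?thesis using C(3) by simp
  qed
  define fac where "fac = the_inv_into N u"
  have fac: "fac (u G) = G" if "G \<in> N" for G
    using the_inv_into_f_f [OF inj_u that] by (simp add: fac_def)
  \<comment> \<open>The outer normal is reversed and divided by the slack t at the far end, so that
    the form takes the value 1 on the edge vector.\<close>
  define \<alpha> where "\<alpha> w = (- 1 / t (fac w)) *\<^sub>R a (fac w)" for w
  have \<alpha>: "\<alpha> (u G) \<bullet> (x - v) = (b G - a G \<bullet> x) / t G" if "G \<in> N" for G x
    using fac [OF that] N_eq(3) [OF that] by (simp add: \<alpha>_def inner_diff_right diff_divide_distrib)
  have "adapter_frame P v (u ` N) \<alpha>"
  proof
    show "d_polytope P" "v extreme_point_of P" "finite (u ` N)" "v \<notin> u ` N"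
      using P vext finN u_neq by auto
    show "card (u ` N) = DIM('a)" using card_image [OF inj_u] cardN by simp
    show "w extreme_point_of P" "closed_segment v w face_of P" if "w \<in> u ` N" for w
      using that u_ext E_segment E_face by (force, metis imageE)
    show "convex hull (insert v (u ` N - {w})) face_of P" if w: "w \<in> u ` N" for w
    proof -
      obtain G where G: "G \<in> N" "w = u G" using w by blast
      have "u ` N - {w} = u ` (N - {G})" using G inj_u by (auto simp: inj_on_def)
      then show ?thesis using facet_hull [OF G(1)] N_eq(4) [OF G(1)] by simp
    qed
    show "\<alpha> w \<bullet> (w' - v) = (if w' = w then 1 else 0)" if ww: "w \<in> u ` N" "w' \<in> u ` N" for w w'
    proof -
      obtain G H where GH: "G \<in> N" "w = u G" "H \<in> N" "w' = u H" using ww by blast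
      have "w' = w \<longleftrightarrow> H = G" using GH inj_u by (auto simp: inj_on_def)
      then show ?thesis using \<alpha> [OF GH(1)] au [OF GH(3,1)] tpos [OF GH(1)] GH by simp
    qed
    show "0 \<le> \<alpha> w \<bullet> (x - v)" if x: "x \<in> P" and w: "w \<in> u ` N" for x w
    proof -
      obtain G where "G \<in> N" "w = u G" using w by blast
      then show ?thesis using \<alpha> [of G x] tpos [of G] N_eq(2) [of G x] x by simp
    qed
    show "x = v + (\<Sum>w\<in>u ` N. (\<alpha> w \<bullet> (x - v)) *\<^sub>R (w - v))" for x
    proof -
      have "(\<Sum>w\<in>u ` N. (\<alpha> w \<bullet> (x - v)) *\<^sub>R (w - v)) = (\<Sum>G\<in>N. (\<alpha> (u G) \<bullet> (x - v)) *\<^sub>R (u G - v))"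
        by (simp add: sum.reindex [OF inj_u])
      also have "\<dots> = (\<Sum>G\<in>N. (b G - a G \<bullet> x) *\<^sub>R e G)"
      proof (rule sum.cong)
        fix G assume "G \<in> N"
        then show "(\<alpha> (u G) \<bullet> (x - v)) *\<^sub>R (u G - v) = (b G - a G \<bullet> x) *\<^sub>R e G"
          using \<alpha> [of G x] u_eq [of G] tpos [of G] by simp
      qed simp
      finally have "(\<Sum>w\<in>u ` N. (\<alpha> w \<bullet> (x - v)) *\<^sub>R (w - v)) = x - v" using expand [of x] by simp
      then show ?thesis by (metis add.commute diff_add_cancel)
    qed
  qed
  then show thesis using that by blast
qed

section \<open>The hyperplane through the neighbors and the two pieces it cuts from P\<close>

section \<open>Cutting off an adapter vertex\<close>

context adapter_frame begin

text \<open>The sum of the coordinates in the cone at v. It vanishes at v and equals 1 on all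
  neighbors, so the cutting hyperplane is its level set 1.\<close>

definition height :: "'a \<Rightarrow> real" where
  "height x = (\<Sum>w\<in>U. \<alpha> w) \<bullet> (x - v)"

lemma height_eq: "height x = (\<Sum>w\<in>U. \<alpha> w \<bullet> (x - v))"
  by (simp add: height_def inner_sum_left)

lemma height_v: "height v = 0"
  by (simp add: height_def)

lemma height_U: "w \<in> U \<Longrightarrow> height w = 1"
  using finU by (simp add: height_eq dual)

lemma height_le_eq: "height x \<le> r \<longleftrightarrow> (\<Sum>w\<in>U. \<alpha> w) \<bullet> x \<le> r + (\<Sum>w\<in>U. \<alpha> w) \<bullet> v"
  and height_ge_eq: "height x \<ge> r \<longleftrightarrow> (\<Sum>w\<in>U. \<alpha> w) \<bullet> x \<ge> r + (\<Sum>w\<in>U. \<alpha> w) \<bullet> v"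
  by (auto simp: height_def inner_diff_right)

lemma convex_height: "convex {x. height x \<le> r}" "convex {x. height x \<ge> r}"
  unfolding height_le_eq height_ge_eq
  by (rule convex_halfspace_le, rule convex_halfspace_ge)

lemma U_nonempty: "U \<noteq> {}"
  using cardU by auto

abbreviation "corner \<equiv> convex hull (insert v U)"

lemma corner_subset: "corner \<subseteq> P"
  using d_polytope_facts(2) [OF P] vP UP by (simp add: hull_minimal)

lemma corner_height: "corner \<subseteq> {x. height x \<le> 1}"
  by (rule hull_minimal) (use height_v height_U convex_height in auto)

lemma in_corner:
  assumes "x \<in> P" "height x \<le> 1"
  shows "x \<in> corner"
proof -
  have "v + (\<Sum>w\<in>U. (\<alpha> w \<bullet> (x - v)) *\<^sub>R (w - v)) \<in> corner"
    by (rule convex_hull_insert_cone) (use finU nonneg assms height_eq in auto)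
  then show ?thesis using expand [of x] by simp
qed

text \<open>Radial projection from v onto level 1 divides the coordinates by their sum, which leaves
  convex weights on U.\<close>

lemma in_base:
  assumes "x \<in> P" "height x > 0"
  shows "v + (1 / height x) *\<^sub>R (x - v) \<in> convex hull U"
proof -
  let ?c = "\<lambda>w. (\<alpha> w \<bullet> (x - v)) / height x"
  have c: "sum ?c U = 1"
    using assms(2) by (simp add: height_eq flip: sum_divide_distrib)
  have "(\<Sum>w\<in>U. ?c w *\<^sub>R w) \<in> convex hull U"
    by (rule convex_sum) (use finU c nonneg assms in \<open>auto simp: hull_inc\<close>)
  moreover have "(\<Sum>w\<in>U. ?c w *\<^sub>R w) = v + (\<Sum>w\<in>U. ?c w *\<^sub>R (w - v))"
    using c by (simp add: scaleR_diff_right sum_subtractf flip: scaleR_sum_left)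
  moreover have "(\<Sum>w\<in>U. ?c w *\<^sub>R (w - v)) = (1 / height x) *\<^sub>R (\<Sum>w\<in>U. (\<alpha> w \<bullet> (x - v)) *\<^sub>R (w - v))"
    by (simp add: scaleR_sum_right)
  moreover have "(\<Sum>w\<in>U. (\<alpha> w \<bullet> (x - v)) *\<^sub>R (w - v)) = x - v"
    using expand [of x] by (metis add_diff_cancel_left')
  ultimately show ?thesis by simp
qed

lemma base_eq: "vertex_base P v = convex hull U"
  by (simp add: vertex_base_def neighbors_eq)

lemma base_height: "convex hull U \<subseteq> {x. height x = 1}"
proof -
  have "convex {x. height x = 1}"
    using convex_Int [OF convex_height(1) [of 1] convex_height(2) [of 1]]
    by (simp add: Int_def conj_commute order.eq_iff)
  then show ?thesis by (intro hull_minimal) (use height_U in auto)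
qed

lemma remove_subset: "remove_vertex P v \<subseteq> P"
  unfolding remove_vertex_def
  by (rule hull_minimal) (use d_polytope_facts(2) [OF P] in \<open>auto simp: extreme_point_of_def\<close>)

lemma convex_remove: "convex (remove_vertex P v)"
  by (simp add: remove_vertex_def)

text \<open>A vertex below level 1 would lie in the corner simplex and be one of its vertices, but
  apart from v these have height 1.\<close>

lemma extreme_height:
  assumes w: "w extreme_point_of P" "w \<noteq> v"
  shows "height w \<ge> 1"
proof (rule ccontr)
  assume less: "\<not> 1 \<le> height w"
  have "w \<in> corner" by (rule in_corner) (use w less in \<open>auto simp: extreme_point_of_def\<close>)
  then have "w extreme_point_of corner"
    using w(1) corner_subset by (auto simp: extreme_point_of_def)
  then have "w \<in> insert v U"
    using extreme_point_of_convex_hull by blast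
  then show False using w(2) height_U less by auto
qed

lemma remove_height: "remove_vertex P v \<subseteq> {x. height x \<ge> 1}"
  unfolding remove_vertex_def
  by (rule hull_minimal) (use extreme_height convex_height in auto)

lemma base_subset: "convex hull U \<subseteq> remove_vertex P v"
  unfolding remove_vertex_def by (rule hull_mono) (use U_ext vU in auto)

text \<open>By Krein-Milman, x lies on a segment from v to a point b of
  \<open>remove_vertex P v\<close>. Its radial projection m to level 1 is in the base, and x lies
  between m and b.\<close>

lemma in_remove:
  assumes x: "x \<in> P" "height x \<ge> 1"
  shows "x \<in> remove_vertex P v"
proof -
  let ?X = "{w. w extreme_point_of P} - {v}"
  have "?X \<noteq> {}" using U_nonempty U_ext vU by auto
  moreover have "insert v ?X = {w. w extreme_point_of P}" using v_ext by auto
  then have "x \<in> convex hull (insert v ?X)"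
    using x(1) Krein_Milman_Minkowski [OF polytope_imp_compact [OF d_polytope_facts(1) [OF P]] d_polytope_facts(2) [OF P]]
    by simp
  ultimately obtain r s b where rs: "r \<ge> 0" "s \<ge> 0" "r + s = 1" "b \<in> remove_vertex P v"
    and x_eq: "x = r *\<^sub>R v + s *\<^sub>R b"
    unfolding convex_hull_insert [OF \<open>?X \<noteq> {}\<close>] remove_vertex_def by blast
  have xb: "x = v + s *\<^sub>R (b - v)"
  proof -
    have "r = 1 - s" using rs(3) by simp
    then show ?thesis unfolding x_eq by (simp add: scaleR_diff_left scaleR_diff_right)
  qed
  define k where "k = 1 / height x"
  have k: "0 < k" "k \<le> 1" using x(2) by (auto simp: k_def)
  define m where "m = v + k *\<^sub>R (x - v)"
  have m: "m \<in> remove_vertex P v"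
    using in_base [OF x(1)] x(2) base_subset by (auto simp: m_def k_def)
  show ?thesis
  proof (cases "k * s = 1")
    case True
    then have "s = 1" using k rs by (smt (verit) mult_left_le_one_le)
    then show ?thesis using xb rs(4) by simp
  next
    case False
    moreover have "k * s \<le> 1" using k rs by (simp add: mult_le_one)
    ultimately have ks: "k * s < 1" by simp
    \<comment> \<open>Since m = v + k s (b - v) and x = v + s (b - v), the weight l has to solve (1
      - l) k s + l = s.\<close>
    define l where "l = (s - k * s) / (1 - k * s)"
    have l: "0 \<le> l" "l \<le> 1" using ks k rs by (auto simp: l_def divide_simps mult_left_le_one_le)
    have "l * (1 - k * s) = s - k * s" using ks by (simp add: l_def)
    then have ls: "(1 - l) * (k * s) + l = s" by (simp add: algebra_simps)
    have "(1 - l) *\<^sub>R m + l *\<^sub>R b = v + ((1 - l) * (k * s) + l) *\<^sub>R (b - v)"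
      by (simp add: m_def xb algebra_simps)
    also have "\<dots> = x" using ls xb by simp
    finally show ?thesis
      using convexD_alt [OF convex_remove m rs(4) l] by simp
  qed
qed

lemma base_eq_Int: "convex hull U = remove_vertex P v \<inter> {x. height x = 1}"
proof
  show "convex hull U \<subseteq> remove_vertex P v \<inter> {x. height x = 1}"
    using base_subset base_height by blast
  show "remove_vertex P v \<inter> {x. height x = 1} \<subseteq> convex hull U"
    using in_base remove_subset by force
qed

lemma indep_U: "\<not> affine_dependent U"
  using affine_independent affine_dependent_subset by blast

lemma aff_dim_base: "aff_dim (convex hull U) = int DIM('a) - 1"
  using aff_dim_affine_independent [OF indep_U] cardU by (simp add: aff_dim_convex_hull)

lemma polytope_remove: "polytope (remove_vertex P v)"
  unfolding remove_vertex_def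
  by (rule polytope_convex_hull)
     (use finite_polyhedron_extreme_points [OF polytope_imp_polyhedron] d_polytope_facts(1) [OF P] in auto)

lemma base_face: "convex hull U face_of remove_vertex P v"
proof -
  let ?n = "\<Sum>w\<in>U. \<alpha> w"
  have "remove_vertex P v \<inter> {x. ?n \<bullet> x = 1 + ?n \<bullet> v} face_of remove_vertex P v"
    by (rule face_of_Int_supporting_hyperplane_ge [OF convex_remove])
       (use remove_height height_ge_eq in auto)
  moreover have "{x. ?n \<bullet> x = 1 + ?n \<bullet> v} = {x. height x = 1}"
    by (auto simp: height_def inner_diff_right)
  ultimately show ?thesis using base_eq_Int by simp
qed

lemma simplex_corner: "int DIM('a) simplex corner"
  unfolding simplex_def using affine_independent cardU vU finU
  by (intro exI [of _ "insert v U"]) simp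

lemma P_eq: "P = remove_vertex P v \<union> corner"
  using in_corner in_remove corner_subset remove_subset by fastforce

text \<open>This is the condition on proper faces in \<open>face_glueing\<close> for the cut of P.
  The omitted vertex w selects a simplex facet of P at v that has K as a face.\<close>

lemma base_proper_face:
  assumes "K face_of convex hull U" "K \<noteq> convex hull U"
  shows "K face_of P"
proof -
  obtain C where C: "C \<subseteq> U" "K = convex hull C"
    using assms(1) face_of_convex_hull_affine_independent [OF indep_U] by blast
  have "C \<noteq> U" using C(2) assms(2) by auto
  then obtain w where w: "w \<in> U" "w \<notin> C" using C(1) by blast
  have ind: "\<not> affine_dependent (insert v (U - {w}))"
    using affine_dependent_subset [OF _ insert_mono] affine_independent by blast
  have "K face_of convex hull (insert v (U - {w}))"
    unfolding face_of_convex_hull_affine_independent [OF ind] using C w by blast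
  then show ?thesis using facet_faces [OF w(1)] face_of_trans by blast
qed

text \<open>The base is a face of \<open>remove_vertex P v\<close> of dimension d - 1. As the two
  sets differ, the latter is full-dimensional.\<close>

lemma remove_glueing:
  assumes "remove_vertex P v \<noteq> convex hull U"
  shows "face_glueing (remove_vertex P v) corner (convex hull U) P"
proof
  have "aff_dim (convex hull U) < aff_dim (remove_vertex P v)"
    using face_of_aff_dim_lt [OF convex_remove base_face] assms by simp
  then have dim: "aff_dim (remove_vertex P v) = int DIM('a)"
    using aff_dim_base aff_dim_le_DIM [of "remove_vertex P v"] by simp
  then show "d_polytope (remove_vertex P v)" by (simp add: d_polytope_def polytope_remove)
  have ne: "convex hull U \<noteq> {}" using U_nonempty by simp
  show "convex hull U facet_of remove_vertex P v"
    using base_face ne aff_dim_base dim by (simp add: facet_of_def)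
  have dimc: "aff_dim corner = int DIM('a)" using aff_dim_simplex [OF simplex_corner] .
  then show "d_polytope corner" using finU by (simp add: d_polytope_def polytope_convex_hull)
  have "convex hull U face_of corner"
    unfolding face_of_convex_hull_affine_independent [OF affine_independent] by blast
  then show "convex hull U facet_of corner"
    using ne aff_dim_base dimc by (simp add: facet_of_def)
  have "convex hull U \<subseteq> corner" by (rule hull_mono) auto
  then show "remove_vertex P v \<inter> corner = convex hull U"
    using base_eq_Int remove_height corner_height by fastforce
qed (use P_eq d_polytope_facts(2) [OF P] base_proper_face in auto)

text \<open>Keeps the additional facet of P available for the glued polytope. A facet of the corner
  that misses v can only be the base, which is no face of P.\<close>

lemma facet_face_of_remove:
  assumes "remove_vertex P v \<noteq> convex hull U"
    and G: "G facet_of P" "v \<notin> G"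
  shows "G face_of remove_vertex P v" "G \<noteq> convex hull U"
proof -
  interpret gl: face_glueing "remove_vertex P v" corner "convex hull U" P
    using remove_glueing [OF assms(1)] .
  have dimG: "aff_dim G = int DIM('a) - 1"
    using G(1) d_polytope_facts(4) [OF P] by (simp add: facet_of_def)
  then have *: "G face_of remove_vertex P v \<or> G face_of corner" "G \<noteq> convex hull U"
    using gl.face_of_R_iff [of G] facet_of_imp_face_of [OF G(1)] by auto
  have "\<not> G face_of corner"
  proof
    assume "G face_of corner"
    then obtain C where C: "C \<subseteq> insert v U" "G = convex hull C"
      unfolding face_of_convex_hull_affine_independent [OF affine_independent] by blast
    then have CU: "C \<subseteq> U" using G(2) hull_inc [of v C convex] by blast
    then have "\<not> affine_dependent C" using indep_U affine_dependent_subset by blast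
    then have "card C = card U"
      using aff_dim_affine_independent [of C] dimG C(2) cardU by (simp add: aff_dim_convex_hull)
    then have "C = U" using card_subset_eq [OF finU CU] by blast
    then show False using C *(2) by simp
  qed
  then show "G face_of remove_vertex P v" "G \<noteq> convex hull U" using * by auto
qed

end

lemma adapter_pair_frame:
  fixes P :: "'a::euclidean_space set"
  assumes "adapter_polytope P" "adapter_pair P v G"
  obtains U \<alpha> where "adapter_frame P v U \<alpha>"
  by (rule adapter_frame_exists [of P v])
     (use assms in \<open>auto simp: adapter_polytope_def adapter_pair_def\<close>)

lemma boxplus_simplex:
  "boxplus DIM('a) (simplex_f_vector DIM('a)) (f_vector Q) = f_vector Q"
  for Q :: "'a::euclidean_space set"
  by (rule ext) (simp add: boxplus_def f_vector_def)

lemma adapter_glueing_result: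
  fixes P Q :: "'a::euclidean_space set"
  assumes adP: "adapter_polytope P" "adapter_pair P v G"
    and Q: "adapter_polytope Q" "adapter_pair Q w F"
    and R: "adapter_glueing P v Q F R"
  shows "adapter_polytope R" "boxplus DIM('a) (f_vector P) (f_vector Q) = f_vector R"
proof -
  obtain U \<alpha> where "adapter_frame P v U \<alpha>" using adapter_pair_frame [OF adP] .
  then interpret adapter_frame P v U \<alpha> .
  obtain \<pi> where all: "projective_on (remove_vertex P v) \<pi> \<and>
    \<pi> ` remove_vertex P v \<inter> Q = F \<and> \<pi> ` vertex_base P v = F \<and>
    R = \<pi> ` remove_vertex P v \<union> Q \<and> convex R \<and>
    (\<forall>K. K face_of F \<and> K \<noteq> F \<longrightarrow> K face_of R)"
    using R unfolding adapter_glueing_def by (rule exE)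
  note \<pi> = conjunct1 [OF all] all [THEN conjunct2, THEN conjunct1]
    all [THEN conjunct2, THEN conjunct2, THEN conjunct1]
    all [THEN conjunct2, THEN conjunct2, THEN conjunct2, THEN conjunct1]
    all [THEN conjunct2, THEN conjunct2, THEN conjunct2, THEN conjunct2, THEN conjunct1]
  have proper: "\<And>K. K face_of F \<Longrightarrow> K \<noteq> F \<Longrightarrow> K face_of R"
    using all [THEN conjunct2, THEN conjunct2, THEN conjunct2, THEN conjunct2, THEN conjunct2] by simp
  obtain L M where LM: "projectivity L M" and dom: "remove_vertex P v \<subseteq> proj_dom L"
    and \<pi>L: "\<And>x. x \<in> remove_vertex P v \<Longrightarrow> \<pi> x = proj_map L x"
    by (rule projective_on_convexD [OF \<pi>(1) convex_remove]) blast
  interpret projectivity L M by (rule LM)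
  have base_dom: "convex hull U \<subseteq> proj_dom L" using base_subset dom by blast
  define A where "A = proj_map L ` remove_vertex P v"
  have A_eq: "\<pi> ` remove_vertex P v = A"
    unfolding A_def by (rule image_cong) (use \<pi>L in auto)
  have F_eq: "F = proj_map L ` (convex hull U)"
    unfolding \<pi>(3) [symmetric] base_eq by (rule image_cong) (use \<pi>L base_subset in auto)
  have FQ: "F facet_of Q" and wF: "w \<notin> F" and simple_w: "simple_vertex Q w"
    and card_w: "card {G. simplex_facet Q G \<and> w \<in> G} = DIM('a)"
    using Q(2) by (auto simp: adapter_pair_def simplex_facet_def)
  have dQ: "d_polytope Q" using Q(1) by (simp add: adapter_polytope_def)
  have "adapter_polytope R \<and> boxplus DIM('a) (f_vector P) (f_vector Q) = f_vector R"
  proof (cases "remove_vertex P v = convex hull U")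
    \<comment> \<open>Here P is the corner simplex, the neutral element, and only F is glued onto
      Q.\<close>
    case True
    then have "A = F" by (simp add: A_def F_eq)
    then have "R = Q" using \<pi>(4) A_eq facet_of_imp_subset [OF FQ] by auto
    have "convex hull U \<subseteq> corner" by (rule hull_mono) auto
    then have "P = corner" using P_eq True by auto
    then have "f_vector P = simplex_f_vector DIM('a)"
      using f_vector_simplex simplex_corner by metis
    then show ?thesis using boxplus_simplex Q(1) \<open>R = Q\<close> by simp
  next
    case False
    interpret gP: face_glueing "remove_vertex P v" corner "convex hull U" P
      by (rule remove_glueing [OF False])
    have dA: "d_polytope A"
      unfolding d_polytope_def A_def
      using polytope_proj_map_image [OF dom polytope_remove] aff_dim_proj_map [OF dom]
        d_polytope_facts(4) [OF gP.A] by simp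
    have FA: "F facet_of A"
      unfolding facet_of_def
    proof (intro conjI)
      show "F face_of A" unfolding A_def F_eq using face_of_proj_map_image [OF dom base_face] .
      show "F \<noteq> {}" using F_eq U_nonempty by simp
      show "aff_dim F = aff_dim A - 1"
        using F_eq aff_dim_proj_map [OF base_dom] aff_dim_base d_polytope_facts(4) [OF dA] by simp
    qed
    interpret gR: face_glueing A Q F R
      by unfold_locales (use dA dQ FA FQ \<pi>(2,4,5) A_eq proper in auto)
    have dR: "d_polytope R" by (rule gR.d_polytope_R)
    have facet_R: "X facet_of R \<longleftrightarrow> (X facet_of A \<or> X facet_of Q) \<and> X \<noteq> F" for X
      using gR.face_of_R_iff [of X] d_polytope_facts(4) [OF dR] d_polytope_facts(4) [OF dA]
        d_polytope_facts(4) [OF dQ]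
      by (auto simp: facet_of_def)
    have wQ: "w extreme_point_of Q" using simple_w by (simp add: simple_vertex_def)
    then have "w \<in> Q" by (simp add: extreme_point_of_def)
    then have wA: "w \<notin> A" using \<pi>(2) A_eq wF by blast
    \<comment> \<open>Since w lies neither in A nor in F, glueing affects no facet through
      w.\<close>
    have facets_w: "X facet_of R \<and> w \<in> X \<longleftrightarrow> X facet_of Q \<and> w \<in> X" for X
      using facet_R [of X] wA wF facet_of_imp_subset [of X A] by blast
    have "{w} face_of R"
      using gR.face_of_R_iff [of "{w}"] wQ wF by (auto simp: face_of_singleton)
    then have "simple_vertex R w"
      using simple_w facets_w by (simp add: simple_vertex_def face_of_singleton)
    moreover have "card {G. simplex_facet R G \<and> w \<in> G} = DIM('a)"
    proof -
      have "{G. simplex_facet R G \<and> w \<in> G} = {G. simplex_facet Q G \<and> w \<in> G}"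
        using facets_w by (auto simp: simplex_facet_def)
      then show ?thesis using card_w by simp
    qed
    moreover have "simplex_facet R (proj_map L ` G)" "w \<notin> proj_map L ` G"
    proof -
      have G: "G facet_of P" "(int DIM('a) - 1) simplex G" "v \<notin> G"
        using adP(2) by (auto simp: adapter_pair_def simplex_facet_def)
      note G' = facet_face_of_remove [OF False G(1,3)]
      have GP: "G \<subseteq> remove_vertex P v" using G'(1) face_of_imp_subset by blast
      then have Gdom: "G \<subseteq> proj_dom L" using dom by blast
      have simp: "(int DIM('a) - 1) simplex (proj_map L ` G)" using simplex_proj_map [OF Gdom G(2)] .
      have "proj_map L ` G \<noteq> F"
        unfolding F_eq using G'(2) inj_on_image_eq_iff [OF inj_on_proj_map Gdom base_dom] by blast
      moreover have "proj_map L ` G facet_of A"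
        unfolding facet_of_def
      proof (intro conjI)
        show "proj_map L ` G face_of A" unfolding A_def using face_of_proj_map_image [OF dom G'(1)] .
        show "proj_map L ` G \<noteq> {}" using G(1) by (auto simp: facet_of_def)
        show "aff_dim (proj_map L ` G) = aff_dim A - 1"
          using aff_dim_simplex [OF simp] d_polytope_facts(4) [OF dA] by simp
      qed
      ultimately show "simplex_facet R (proj_map L ` G)"
        using facet_R simp by (simp add: simplex_facet_def)
      show "w \<notin> proj_map L ` G" using wA GP by (auto simp: A_def)
    qed
    ultimately have "adapter_pair R w (proj_map L ` G)" by (simp add: adapter_pair_def)
    then have adR: "adapter_polytope R" using dR by (auto simp: adapter_polytope_def)
    have "boxplus DIM('a) (f_vector P) (f_vector Q) i = f_vector R i" for i
    proof (cases "i < DIM('a)")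
      case i: True
      then have i': "int i < int DIM('a)" by simp
      have "simplex_f_vector DIM('a) i = f_vector corner i"
        using f_vector_simplex [OF simplex_corner] by simp
      then have "simplex_f_vector DIM('a) i = int (card (faces_dim (int i) corner))"
        using i by (simp add: f_vector_def)
      moreover have "card (faces_dim (int i) A) = card (faces_dim (int i) (remove_vertex P v))"
        unfolding A_def by (rule card_faces_proj_map [OF dom])
      moreover have "card (faces_dim (int i) F) = card (faces_dim (int i) (convex hull U))"
        unfolding F_eq by (rule card_faces_proj_map [OF base_dom])
      ultimately show ?thesis
        using i gP.card_faces_dim_R [OF i'] gR.card_faces_dim_R [OF i']
        by (simp add: boxplus_def f_vector_def)
    qed (simp add: boxplus_def f_vector_def)
    then show ?thesis using adR by blast
  qed
  then show "adapter_polytope R" "boxplus DIM('a) (f_vector P) (f_vector Q) = f_vector R"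
    by auto
qed

section \<open>Squeezing a truncated polytope into a pyramid over a facet\<close>

section \<open>Existence of glueings\<close>

text \<open>In a linear relation among the vectors (x, 1), the last coordinate says that the
  coefficients sum to 0, which makes it an affine relation.\<close>

lemma homogeneous_independent:
  assumes "\<not> affine_dependent S"
  shows "independent ((\<lambda>x. (x, 1::real)) ` S)"
proof
  let ?h = "\<lambda>x::'a. (x, 1::real)"
  assume "dependent (?h ` S)"
  then obtain T u where T: "finite T" "T \<subseteq> ?h ` S" "(\<Sum>p\<in>T. u p *\<^sub>R p) = 0" "\<exists>p\<in>T. u p \<noteq> 0"
    unfolding dependent_explicit by blast
  obtain S' where S': "S' \<subseteq> S" "T = ?h ` S'"
    using T(2) by (auto simp: subset_image_iff)
  have inj: "inj_on ?h S'" by (auto simp: inj_on_def)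
  have fin: "finite S'" using T(1) S'(2) inj finite_imageD by blast
  have "(\<Sum>x\<in>S'. u (?h x) *\<^sub>R ?h x) = 0"
    using T(3) unfolding S'(2) by (simp add: sum.reindex [OF inj] del: scaleR_Pair)
  then have "(\<Sum>x\<in>S'. u (?h x) *\<^sub>R x) = 0" "(\<Sum>x\<in>S'. u (?h x)) = 0"
    by (auto simp: prod_eq_iff fst_sum snd_sum)
  moreover have "\<exists>x\<in>S'. u (?h x) \<noteq> 0" using T(4) S'(2) by auto
  ultimately have "affine_dependent S"
    unfolding affine_dependent_explicit using fin S'(1) by blast
  then show False using assms by blast
qed

text \<open>Stated for every convex X between F and the pyramid over F with apex z, because these
  bounds are all that is known about the projective image when it is glued on.\<close>

lemma apex_beyond_facet:
  fixes Q :: "'a::euclidean_space set"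
  assumes Q: "d_polytope Q" and F: "F facet_of Q"
  obtains z where "z \<notin> affine hull F" "convex hull (insert z F) \<inter> Q = F"
    "\<And>X. convex X \<Longrightarrow> F \<subseteq> X \<Longrightarrow> X \<subseteq> convex hull (insert z F) \<Longrightarrow>
       convex (X \<union> Q) \<and> (\<forall>G. G facet_of Q \<and> G \<noteq> F \<longrightarrow> G face_of X \<union> Q)"
proof -
  note Q' = d_polytope_facts [OF Q]
  obtain a b where
    ab: "\<And>G. G facet_of Q \<Longrightarrow> Q \<subseteq> {x. a G \<bullet> x \<le> b G} \<and> G = Q \<inter> {x. a G \<bullet> x = b G}"
    and inQ: "\<And>x. (\<And>G. G facet_of Q \<Longrightarrow> a G \<bullet> x \<le> b G) \<Longrightarrow> x \<in> Q"
    by (rule facet_halfspaces [OF Q]) blast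
  have le: "a G \<bullet> x \<le> b G" if "G facet_of Q" "x \<in> Q" for G x
    using ab that by blast
  have eq_iff: "x \<in> G \<longleftrightarrow> x \<in> Q \<and> a G \<bullet> x = b G" if "G facet_of Q" for G x
    using ab [OF that] by blast
  have FQ: "F \<subseteq> Q" and F_ne: "F \<noteq> {}" and convF: "convex F"
    using F facet_of_imp_subset [OF F] face_of_imp_convex [OF facet_of_imp_face_of [OF F]]
    by (auto simp: facet_of_def)
  have "F \<noteq> Q" using F by auto
  then obtain p where p: "p \<in> Q" "p \<notin> F" using FQ by blast
  obtain q where q: "q \<in> rel_interior F"
    using rel_interior_eq_empty [OF convF] F_ne by blast
  then have qF: "q \<in> F" using rel_interior_subset by blast
  define N where "N = {G. G facet_of Q \<and> G \<noteq> F}"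
  have finN: "finite N"
    using finite_polytope_facets [OF Q'(1)] by (auto simp: N_def intro: finite_subset [rotated])
  \<comment> \<open>A facet containing a relative interior point of F contains all of F.\<close>
  have q_less: "a G \<bullet> q < b G" if "G \<in> N" for G
  proof (rule ccontr)
    have G: "G facet_of Q" "G \<noteq> F" using that by (auto simp: N_def)
    assume "\<not> a G \<bullet> q < b G"
    then have "q \<in> G" using le [OF G(1)] eq_iff [OF G(1)] qF FQ by force
    then have "F \<subseteq> G"
      using subset_of_face_of [OF facet_of_imp_face_of [OF G(1)] FQ] q by blast
    then show False
      using face_containing_facet [OF Q'(2) F facet_of_imp_face_of [OF G(1)]] G by auto
  qed
  obtain t where t: "t > 0" "\<And>G s. G \<in> N \<Longrightarrow> \<bar>s\<bar> \<le> t \<Longrightarrow> a G \<bullet> q + s * (a G \<bullet> (q - p)) < b G"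
    using small_perturbation [OF finN, of "\<lambda>G. a G \<bullet> q" b "\<lambda>G. a G \<bullet> (q - p)"] q_less by blast
  \<comment> \<open>Continues the ray from p in Q through q slightly beyond F, with t small enough
    to stay beneath the other facets.\<close>
  define z where "z = q + t *\<^sub>R (q - p)"
  have zN: "a G \<bullet> z < b G" if "G \<in> N" for G
    using t that by (simp add: z_def inner_add_right)
  have "a F \<bullet> p < b F" using p le [OF F p(1)] eq_iff [OF F] by force
  moreover have "a F \<bullet> q = b F" using eq_iff [OF F] qF by blast
  ultimately have zF: "a F \<bullet> z > b F"
    using t(1) by (simp add: z_def inner_add_right inner_diff_right)
  let ?T = "convex hull (insert z F)"
  have T_cases: "\<exists>r s f. 0 \<le> r \<and> 0 \<le> s \<and> r + s = 1 \<and> f \<in> F \<and> y = r *\<^sub>R z + s *\<^sub>R f" if "y \<in> ?T" for y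
    using that unfolding convex_hull_insert [OF F_ne] hull_same [of convex, OF convF] by blast
  \<comment> \<open>For y = r z + s f, the strict inequality at z forces r = 0 in the case of
    equality, so y is in F. The same argument gives the next fact for the other facets.\<close>
  have T_F: "a F \<bullet> y \<ge> b F \<and> (a F \<bullet> y = b F \<longrightarrow> y \<in> F)" if y: "y \<in> ?T" for y
  proof -
    obtain r s f where *: "0 \<le> r" "0 \<le> s" "r + s = 1" "f \<in> F" "y = r *\<^sub>R z + s *\<^sub>R f"
      using T_cases [OF y] by blast
    have af: "a F \<bullet> f = b F" using eq_iff [OF F] *(4) by blast
    have "r * b F + s * b F = b F" using *(3) by (metis distrib_right mult_1)
    then have "a F \<bullet> y = b F + r * (a F \<bullet> z - b F)"
      using *(5) af by (simp add: inner_add_right algebra_simps)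
    then show ?thesis using * zF by auto
  qed
  have T_G: "a G \<bullet> y \<le> b G \<and> (a G \<bullet> y = b G \<longrightarrow> y \<in> F)" if y: "y \<in> ?T" and G: "G \<in> N" for y G
  proof -
    obtain r s f where *: "0 \<le> r" "0 \<le> s" "r + s = 1" "f \<in> F" "y = r *\<^sub>R z + s *\<^sub>R f"
      using T_cases [OF y] by blast
    have af: "a G \<bullet> f \<le> b G" using le *(4) FQ G by (auto simp: N_def)
    have r: "r = 1 - s" using *(3) by simp
    have ay: "a G \<bullet> y = r * (a G \<bullet> z) + s * (a G \<bullet> f)"
      using *(5) by (simp add: inner_add_right)
    have 1: "s * (a G \<bullet> f) \<le> s * b G" using af *(2) by (simp add: mult_left_mono)
    have 2: "r * b G + s * b G = b G" using *(3) by (metis distrib_right mult_1)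
    show ?thesis
    proof (cases "r = 0")
      case True
      then show ?thesis using * ay 1 2 by auto
    next
      case False
      then have "r * (a G \<bullet> z) < r * b G" using zN [OF G] *(1) by simp
      then show ?thesis using ay 1 2 by linarith
    qed
  qed
  have TQ: "?T \<inter> Q = F"
  proof
    show "?T \<inter> Q \<subseteq> F" using T_F le [OF F] by force
    show "F \<subseteq> ?T \<inter> Q" using FQ hull_subset [of "insert z F" convex] by auto
  qed
  have "affine hull F \<subseteq> {x. a F \<bullet> x = b F}"
    by (rule hull_minimal) (use eq_iff [OF F] in \<open>auto simp: affine_hyperplane\<close>)
  then have z_aff: "z \<notin> affine hull F" using zF by auto
  show thesis
  proof (rule that [OF z_aff TQ], rule conjI)
    fix X assume X: "convex X" "F \<subseteq> X" "X \<subseteq> ?T"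
    \<comment> \<open>The segment crosses the hyperplane of F at a point m. Both ends satisfy the
      inequalities of the other facets, hence so does m; this puts m into F and splits the segment
      into a part in X and a part in Q.\<close>
    have mixed: "closed_segment x y \<subseteq> X \<union> Q" if x: "x \<in> X" and y: "y \<in> Q" for x y
    proof -
      have xT: "x \<in> ?T" using X x by blast
      have xF: "a F \<bullet> x \<ge> b F" and yF: "a F \<bullet> y \<le> b F" using T_F [OF xT] le [OF F y] by auto
      have "\<exists>m\<in>closed_segment x y. a F \<bullet> m = b F"
      proof (cases "a F \<bullet> x = b F")
        case False
        define k where "k = (a F \<bullet> x - b F) / (a F \<bullet> x - a F \<bullet> y)"
        have pos: "a F \<bullet> x - a F \<bullet> y > 0" using False xF yF by simp
        have k: "0 \<le> k" "k \<le> 1" using pos xF yF by (auto simp: k_def)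
        have "k * (a F \<bullet> x - a F \<bullet> y) = a F \<bullet> x - b F" using pos by (simp add: k_def)
        then have "a F \<bullet> ((1 - k) *\<^sub>R x + k *\<^sub>R y) = b F"
          by (simp add: inner_add_right algebra_simps)
        moreover have "(1 - k) *\<^sub>R x + k *\<^sub>R y \<in> closed_segment x y"
          unfolding in_segment(1) using k by (intro exI [of _ k]) simp
        ultimately show ?thesis by blast
      qed auto
      then obtain m where m: "m \<in> closed_segment x y" "a F \<bullet> m = b F" by blast
      have "m \<in> Q"
      proof (rule inQ)
        fix G assume G: "G facet_of Q"
        show "a G \<bullet> m \<le> b G"
        proof (cases "G = F")
          case False
          then have "G \<in> N" using G by (simp add: N_def)
          then have "closed_segment x y \<subseteq> {u. a G \<bullet> u \<le> b G}"
            using T_G [OF xT] le [OF G y] by (intro closed_segment_subset convex_halfspace_le) auto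
          then show ?thesis using m by blast
        qed (use m in simp)
      qed
      then have mF: "m \<in> F" using eq_iff [OF F] m by blast
      have "closed_segment x m \<subseteq> X" using X(1,2) mF x by (intro closed_segment_subset) auto
      moreover have "closed_segment m y \<subseteq> Q" using mF y FQ Q'(2) by (intro closed_segment_subset) auto
      ultimately show ?thesis using Un_closed_segment [OF m(1)] by blast
    qed
    show conv: "convex (X \<union> Q)"
      unfolding convex_contains_segment
    proof (intro ballI)
      fix x y assume "x \<in> X \<union> Q" "y \<in> X \<union> Q"
      then consider "x \<in> X" "y \<in> X" | "x \<in> Q" "y \<in> Q" | "x \<in> X" "y \<in> Q" | "y \<in> X" "x \<in> Q" by blast
      then show "closed_segment x y \<subseteq> X \<union> Q"
      proof cases
        case 1
        then show ?thesis using closed_segment_subset [OF _ _ X(1)] by blast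
      next
        case 2
        then show ?thesis using closed_segment_subset [OF _ _ Q'(2)] by blast
      next
        case 3
        then show ?thesis using mixed by blast
      next
        case 4
        then show ?thesis using mixed [of y x] by (simp add: closed_segment_commute)
      qed
    qed
    show "\<forall>G. G facet_of Q \<and> G \<noteq> F \<longrightarrow> G face_of X \<union> Q"
    proof (intro allI impI)
      fix G assume G: "G facet_of Q \<and> G \<noteq> F"
      then have GN: "G \<in> N" by (simp add: N_def)
      \<comment> \<open>X touches the hyperplane of G only within F, which lies in Q, so this
        supporting hyperplane cuts out exactly G.\<close>
      have "(X \<union> Q) \<inter> {x. a G \<bullet> x = b G} face_of X \<union> Q"
        by (rule face_of_Int_supporting_hyperplane_le [OF conv])
           (use T_G [OF _ GN] le G X(3) in blast)
      moreover have "(X \<union> Q) \<inter> {x. a G \<bullet> x = b G} = G"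
        using T_G [OF _ GN] eq_iff G X(3) FQ by blast
      ultimately show "G face_of X \<union> Q" by simp
    qed
  qed
qed

text \<open>The vectors (x, 1) for x in \<open>insert v U\<close> are d + 1 independent vectors, so
  a linear map may be prescribed on them freely. Any bijection f between neighbors and vertices of F
  will do.\<close>

lemma adapter_glueing_exists:
  fixes P Q :: "'a::euclidean_space set"
  assumes adP: "adapter_polytope P" "adapter_pair P v G"
    and adQ: "adapter_polytope Q" "adapter_pair Q w F"
  shows "\<exists>R. adapter_glueing P v Q F R"
proof -
  obtain U \<alpha> where "adapter_frame P v U \<alpha>" using adapter_pair_frame [OF adP] .
  then interpret adapter_frame P v U \<alpha> .
  have Q: "d_polytope Q" and FQ: "F facet_of Q" and F_simplex: "(int DIM('a) - 1) simplex F"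
    using adQ by (auto simp: adapter_polytope_def adapter_pair_def simplex_facet_def)
  obtain C where C: "\<not> affine_dependent C" "int (card C) = int DIM('a) - 1 + 1" "F = convex hull C"
    using F_simplex unfolding simplex_def by blast
  have finC: "finite C" using C(1) by (rule aff_independent_finite)
  obtain f where f: "bij_betw f U C"
    using finite_same_card_bij [OF finU finC] cardU C(2) by auto
  obtain z where z: "z \<notin> affine hull F" "convex hull (insert z F) \<inter> Q = F"
    and glue: "\<And>X. convex X \<Longrightarrow> F \<subseteq> X \<Longrightarrow> X \<subseteq> convex hull (insert z F) \<Longrightarrow>
       convex (X \<union> Q) \<and> (\<forall>G. G facet_of Q \<and> G \<noteq> F \<longrightarrow> G face_of X \<union> Q)"
    by (rule apex_beyond_facet [OF Q FQ]) blast
  have zC: "\<not> affine_dependent (insert z C)"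
    using affine_independent_insert [OF C(1)] z(1) C(3) by simp
  let ?h = "\<lambda>x::'a. (x, 1::real)"
  let ?B = "?h ` insert v U"
  define g where "g p = (if fst p = v then - (z, 1) else (f (fst p), 1::real))" for p :: "'a \<times> real"
  have gU: "g (u, 1) = (f u, 1)" if "u \<in> U" for u
    using that vU by (auto simp: g_def)
  have gv: "g (v, 1) = - (z, 1)" by (simp add: g_def)
  have fU: "f ` U = C" using f by (simp add: bij_betw_def)
  have z_notin: "z \<notin> C" using z(1) C(3) by (auto simp: hull_inc)
  have indep_zC: "independent (insert (z, 1) (?h ` C))"
    using homogeneous_independent [OF zC] by simp
  have "independent (insert (- (z, 1)) (?h ` C))"
  proof -
    have "(z, 1) \<notin> ?h ` C" using z_notin by auto
    then have "(z, 1) \<notin> span (?h ` C)" "independent (?h ` C)"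
      using indep_zC independent_insert [of "(z, 1)" "?h ` C"] by auto
    moreover from this have "- (z, 1) \<notin> span (?h ` C)" by (metis minus_minus span_neg)
    ultimately show ?thesis by (intro independent_insertI)
  qed
  moreover have gB: "g ` ?B = insert (- (z, 1)) (?h ` C)"
  proof -
    have "g ` ?h ` U = ?h ` f ` U" using gU by (simp add: image_image)
    then show ?thesis using gv fU by simp
  qed
  ultimately have "independent (g ` ?B)" by simp
  moreover have "inj_on g ?B"
  proof (rule inj_onI)
    fix p q assume "p \<in> ?B" "q \<in> ?B" and eq: "g p = g q"
    then obtain x y where xy: "x \<in> insert v U" "y \<in> insert v U" "p = ?h x" "q = ?h y" by blast
    have "x = y"
    proof (cases "x = v \<or> y = v")
      case True
      have "snd (g p) = snd (g q)" using eq by simp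
      then show ?thesis using True xy by (auto simp: g_def split: if_splits)
    next
      case False
      then have "x \<in> U" "y \<in> U" "f x = f y" using xy eq gU by auto
      then show ?thesis using f by (auto simp: bij_betw_def inj_on_def)
    qed
    then show "p = q" using xy by simp
  qed
  ultimately obtain L where L: "linear L" "inj L" and Lg: "\<And>p. p \<in> ?B \<Longrightarrow> L p = g p"
    using linear_independent_extend_inj [OF homogeneous_independent [OF affine_independent]] by blast
  have LU: "L (u, 1) = (f u, 1)" if "u \<in> U" for u using Lg [of "(u, 1)"] gU that by simp
  have Lv: "L (v, 1) = - (z, 1)" using Lg [of "(v, 1)"] gv by simp
  have bij: "bij L" using L linear_injective_imp_surjective [OF L] by (simp add: bij_def)
  obtain M where M: "linear M" "\<And>x. M (L x) = x" "\<And>x. L (M x) = x"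
    using linear_injective_isomorphism [OF L] by metis
  interpret projectivity L M by (rule projectivity.intro) (rule L M)+
  \<comment> \<open>Writing x as an affine combination of U and v, the point v gets the weight 1 -
    height x. The sign in \<open>gv\<close> turns this into height x - 1 in front of z.\<close>
  have Lx: "L (x, 1) = ((\<Sum>u\<in>U. (\<alpha> u \<bullet> (x - v)) *\<^sub>R f u) + (height x - 1) *\<^sub>R z, 2 * height x - 1)" for x
  proof -
    let ?c = "\<lambda>u. \<alpha> u \<bullet> (x - v)"
    have "(x, 1::real) = (\<Sum>u\<in>U. ?c u *\<^sub>R (u, 1)) + (1 - height x) *\<^sub>R (v, 1)"
    proof -
      have "v + (\<Sum>u\<in>U. ?c u *\<^sub>R (u - v)) = (\<Sum>u\<in>U. ?c u *\<^sub>R u) + (1 - height x) *\<^sub>R v"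
        by (simp add: height_eq scaleR_diff_right scaleR_diff_left sum_subtractf scaleR_sum_left)
      from trans [OF expand this]
      have "x = (\<Sum>u\<in>U. ?c u *\<^sub>R u) + (1 - height x) *\<^sub>R v" .
      moreover have "1 = (\<Sum>u\<in>U. ?c u) + (1 - height x)" by (simp add: height_eq)
      ultimately show ?thesis by (simp add: prod_eq_iff fst_sum snd_sum)
    qed
    then have "L (x, 1) = (\<Sum>u\<in>U. ?c u *\<^sub>R L (u, 1)) + (1 - height x) *\<^sub>R L (v, 1)"
      by (simp add: linear_add [OF L(1)] linear_sum [OF L(1)] linear_cmul [OF L(1)] del: scaleR_Pair)
    also have "(\<Sum>u\<in>U. ?c u *\<^sub>R L (u, 1)) = (\<Sum>u\<in>U. ?c u *\<^sub>R (f u, 1))"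
      by (rule sum.cong) (use LU in auto)
    finally show ?thesis
      unfolding Lv by (simp add: prod_eq_iff fst_sum snd_sum height_eq algebra_simps)
  qed
  have dom: "remove_vertex P v \<subseteq> proj_dom L"
    using remove_height by (force simp: proj_dom_def Lx)
  let ?A = "proj_map L ` remove_vertex P v"
  have base_image: "proj_map L ` (convex hull U) = F"
  proof -
    have "proj_map L ` U = f ` U"
      by (rule image_cong) (use LU in \<open>auto simp: proj_map_def\<close>)
    moreover have "U \<subseteq> proj_dom L" using LU by (auto simp: proj_dom_def)
    ultimately show ?thesis using proj_map_convex_hull fU C(3) by simp
  qed
  have A_sub: "?A \<subseteq> convex hull (insert z F)"
  proof
    fix y assume "y \<in> ?A"
    then obtain x where x: "x \<in> remove_vertex P v" "y = proj_map L x" by blast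
    have h: "height x \<ge> 1" and xP: "x \<in> P" using x(1) remove_height remove_subset by auto
    let ?c = "\<lambda>u. (\<alpha> u \<bullet> (x - v)) / height x"
    define b where "b = (\<Sum>u\<in>U. ?c u *\<^sub>R f u)"
    have "sum ?c U = 1" using h by (simp add: height_eq flip: sum_divide_distrib)
    then have "b \<in> F" unfolding b_def C(3)
      by (intro convex_sum) (use finU fU nonneg xP h in \<open>auto simp: hull_inc\<close>)
    then have bT: "b \<in> convex hull (insert z F)" by (simp add: hull_inc)
    have zT: "z \<in> convex hull (insert z F)" by (simp add: hull_inc)
    define s where "s = 2 * height x - 1"
    have s: "s > 0" using h by (simp add: s_def)
    have "height x *\<^sub>R b = (\<Sum>u\<in>U. (\<alpha> u \<bullet> (x - v)) *\<^sub>R f u)"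
      using h by (simp add: b_def scaleR_sum_right)
    then have "y = inverse s *\<^sub>R (height x *\<^sub>R b + (height x - 1) *\<^sub>R z)"
      by (simp add: x(2) proj_map_def Lx s_def)
    \<comment> \<open>The two weights are nonnegative as height x is at least 1, and sum to 1 by the
      choice of s.\<close>
    also have "\<dots> = (height x / s) *\<^sub>R b + ((height x - 1) / s) *\<^sub>R z"
      by (simp add: scaleR_add_right divide_inverse mult.commute)
    also have "\<dots> \<in> convex hull (insert z F)"
      by (rule convexD [OF convex_convex_hull bT zT])
         (use h s in \<open>auto simp: s_def simp flip: add_divide_distrib\<close>)
    finally show "y \<in> convex hull (insert z F)" .
  qed
  have FA: "F \<subseteq> ?A" using base_image base_subset by blast
  have A_conv: "convex ?A" using convex_proj_map_image [OF dom convex_remove] .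
  have faces: "\<And>G. G facet_of Q \<Longrightarrow> G \<noteq> F \<Longrightarrow> G face_of ?A \<union> Q" and convR: "convex (?A \<union> Q)"
    using glue [OF A_conv FA A_sub] by auto
  have "K face_of ?A \<union> Q" if K: "K face_of F" "K \<noteq> F" for K
  proof (cases "K = {}")
    case False
    have KQ: "K face_of Q" using face_of_trans [OF K(1) facet_of_imp_face_of [OF FQ]] .
    have KF: "K \<subseteq> F" using face_of_imp_subset [OF K(1)] .
    have "K \<noteq> Q" using KF K(2) facet_of_imp_subset [OF FQ] by blast
    \<comment> \<open>K is the intersection of the facets of Q containing it. As K is not F, one of
      them is a facet G other than F, and such G remain faces of the union.\<close>
    then have K_eq: "K = \<Inter> {G. G facet_of Q \<and> K \<subseteq> G}"
      using face_of_polyhedron [OF polytope_imp_polyhedron [OF d_polytope_facts(1) [OF Q]] KQ False] by blast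
    have "\<exists>G. G facet_of Q \<and> K \<subseteq> G \<and> G \<noteq> F"
    proof (rule ccontr)
      assume "\<not> ?thesis"
      then have "{G. G facet_of Q \<and> K \<subseteq> G} = {F}" using FQ KF by blast
      then show False using K_eq K(2) by simp
    qed
    then obtain G where G: "G facet_of Q" "K \<subseteq> G" "G \<noteq> F" by blast
    then have "K face_of G" using face_of_subset [OF KQ] facet_of_imp_subset by blast
    then show ?thesis using face_of_trans faces [OF G(1,3)] by blast
  qed simp
  moreover have "projective_on (remove_vertex P v) (proj_map L)"
    unfolding projective_on_def using L(1) bij dom by (force simp: proj_dom_def)
  moreover have "?A \<inter> Q = F" using FA A_sub z(2) facet_of_imp_subset [OF FQ] by blast
  ultimately have "adapter_glueing P v Q F (?A \<union> Q)"
    unfolding adapter_glueing_def using convR base_image base_eq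
    by (intro exI [of _ "proj_map L"]) auto
  then show ?thesis by blast
qed

section \<open>Neutral element and embedding into the integer lattice\<close>

section \<open>The monoid\<close>

text \<open>Provides the neutral element. Any vertex v serves: the facets through v are those
  opposite to the d other vertices, and the additional facet is the one opposite to v.\<close>

lemma simplex_adapter_polytope:
  fixes S :: "'a::euclidean_space set"
  assumes "int DIM('a) simplex S"
  shows "adapter_polytope S"
proof -
  obtain C where C: "\<not> affine_dependent C" "int (card C) = int DIM('a) + 1" "S = convex hull C"
    using assms unfolding simplex_def by blast
  have fin: "finite C" using C(1) by (rule aff_independent_finite)
  have card: "card C = Suc DIM('a)" using C(2) by linarith
  have mem: "x \<in> convex hull (C - {u}) \<longleftrightarrow> u \<noteq> x" if "x \<in> C" for x u
  proof
    assume x: "x \<in> convex hull (C - {u})"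
    show "u \<noteq> x"
    proof
      assume "u = x"
      then have "x \<in> affine hull (C - {x})" using x convex_hull_subset_affine_hull by blast
      then show False using C(1) that by (auto simp: affine_dependent_def)
    qed
  qed (use that in \<open>auto intro: hull_inc\<close>)
  have facet: "T facet_of S \<longleftrightarrow> (\<exists>u\<in>C. T = convex hull (C - {u}))" for T
  proof -
    have "C - {u} \<noteq> {}" if "u \<in> C" for u
      using that card fin card_Diff_singleton [of u C] by (metis card.empty diff_Suc_1 DIM_positive less_irrefl)
    then show ?thesis
      unfolding C(3) facet_of_convex_hull_affine_independent [OF C(1)] by auto
  qed
  have simp: "simplex_facet S T \<longleftrightarrow> T facet_of S" for T
  proof -
    have "(int DIM('a) - 1) simplex (convex hull (C - {u}))" if "u \<in> C" for u
      unfolding simplex_def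
      by (rule exI [of _ "C - {u}"])
         (use C(1) card that fin affine_dependent_subset [of "C - {u}" C] in auto)
    then show ?thesis unfolding simplex_facet_def facet by blast
  qed
  obtain v where v: "v \<in> C" using card by fastforce
  let ?H = "\<lambda>u. convex hull (C - {u})"
  have "{T. T facet_of S \<and> v \<in> T} = ?H ` (C - {v})"
    using facet mem [OF v] by auto
  moreover have "inj_on ?H (C - {v})"
  proof (rule inj_onI)
    fix u u' assume u: "u \<in> C - {v}" "u' \<in> C - {v}" and eq: "?H u = ?H u'"
    have "u \<notin> ?H u" using mem [of u u] u by blast
    then have "u \<notin> ?H u'" unfolding eq .
    then show "u = u'" using mem [of u u'] u by blast
  qed
  moreover have "card (C - {v}) = DIM('a)" using card v fin by simp
  ultimately have card_v: "card {T. T facet_of S \<and> v \<in> T} = DIM('a)"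
    by (simp add: card_image)
  have "v extreme_point_of S"
    unfolding C(3) extreme_point_of_convex_hull_affine_independent [OF C(1)] by (rule v)
  then have "adapter_pair S v (?H v)"
    unfolding adapter_pair_def simple_vertex_def simp
    using card_v facet v mem [OF v, of v] by auto
  moreover have "d_polytope S"
    using simplex_imp_polytope [OF assms] aff_dim_simplex [OF assms] by (simp add: d_polytope_def)
  ultimately show ?thesis by (auto simp: adapter_polytope_def)
qed

lemma full_simplex_exists: "\<exists>S :: 'a::euclidean_space set. int DIM('a) simplex S"
proof -
  have "\<not> affine_dependent (insert (0::'a) Basis)"
    using affine_dependent_iff_dependent [of "0::'a" Basis] independent_Basis by (simp add: image_ident)
  moreover have "card (insert (0::'a) Basis) = Suc DIM('a)"
    by (subst card_insert_disjoint) auto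
  ultimately show ?thesis
    unfolding simplex_def
    by (intro exI [of _ "convex hull (insert 0 Basis)"] exI [of _ "insert (0::'a) Basis"]) auto
qed

lemma carrier_adapter_monoid:
  "carrier (adapter_monoid TYPE('a::euclidean_space)) = {f_vector P |P :: 'a set. adapter_polytope P}"
  and mult_adapter_monoid: "x \<otimes>\<^bsub>adapter_monoid TYPE('a)\<^esub> y = boxplus DIM('a) x y"
  and one_adapter_monoid: "\<one>\<^bsub>adapter_monoid TYPE('a)\<^esub> = simplex_f_vector DIM('a)"
  by (simp_all add: adapter_monoid_def)

lemma boxplus_closed:
  fixes P Q :: "'a::euclidean_space set"
  assumes P: "adapter_polytope P" and Q: "adapter_polytope Q"
  obtains R :: "'a set" where "adapter_polytope R" "boxplus DIM('a) (f_vector P) (f_vector Q) = f_vector R"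
proof -
  obtain v G w F where vw: "adapter_pair P v G" "adapter_pair Q w F"
    using P Q unfolding adapter_polytope_def by blast
  obtain R where "adapter_glueing P v Q F R"
    using adapter_glueing_exists [OF P vw(1) Q vw(2)] by blast
  from adapter_glueing_result [OF P vw(1) Q vw(2) this] show thesis by (rule that)
qed

lemma affine_monoid_adapter_monoid:
  "affine_monoid (adapter_monoid TYPE('a::euclidean_space))"
proof -
  let ?M = "adapter_monoid TYPE('a)"
  let ?d = "DIM('a)"
  note simps = carrier_adapter_monoid mult_adapter_monoid one_adapter_monoid
  \<comment> \<open>The sum takes the value \<open>undefined\<close> outside the index range, so the
    neutral laws hold only for vectors that do the same.\<close>
  have extensional: "x \<in> extensional {..<?d}" if "x \<in> carrier ?M" for x
    using that by (auto simp: simps f_vector_def)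
  have closed: "boxplus ?d x y \<in> carrier ?M" if "x \<in> carrier ?M" "y \<in> carrier ?M" for x y
    using that boxplus_closed unfolding carrier_adapter_monoid by (smt (verit) mem_Collect_eq)
  have mon: "monoid ?M"
  proof (rule monoidI)
    fix x y z assume x: "x \<in> carrier ?M" and y: "y \<in> carrier ?M" and z: "z \<in> carrier ?M"
    show "x \<otimes>\<^bsub>?M\<^esub> y \<in> carrier ?M" using closed x y by (simp add: simps(2))
    show "(x \<otimes>\<^bsub>?M\<^esub> y) \<otimes>\<^bsub>?M\<^esub> z = x \<otimes>\<^bsub>?M\<^esub> (y \<otimes>\<^bsub>?M\<^esub> z)"
      by (rule ext) (simp add: simps(2) boxplus_def)
  next
    fix x assume x: "x \<in> carrier ?M"
    show "\<one>\<^bsub>?M\<^esub> \<otimes>\<^bsub>?M\<^esub> x = x" "x \<otimes>\<^bsub>?M\<^esub> \<one>\<^bsub>?M\<^esub> = x"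
      using extensional [OF x] by (auto simp: simps(2,3) boxplus_def extensional_def fun_eq_iff)
  next
    obtain S :: "'a set" where S: "int DIM('a) simplex S" using full_simplex_exists by blast
    then show "\<one>\<^bsub>?M\<^esub> \<in> carrier ?M"
      using simplex_adapter_polytope [OF S] f_vector_simplex [OF S, symmetric]
      by (auto simp: simps)
  qed
  \<comment> \<open>Translation by the f-vector of the simplex moves the neutral element to 0 and
    turns \<open>boxplus\<close> into ordinary addition.\<close>
  define \<phi> where "\<phi> x = (\<lambda>i\<in>{..<?d}. x i - simplex_f_vector ?d i)" for x
  define S where "S = \<phi> ` carrier ?M"
  have hom: "\<phi> (boxplus ?d x y) = \<phi> x \<otimes>\<^bsub>int_lattice ?d\<^esub> \<phi> y" for x y
    by (rule ext) (simp add: \<phi>_def boxplus_def)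
  have "S \<subseteq> carrier (int_lattice ?d)"
    by (auto simp: S_def \<phi>_def split: if_splits)
  moreover have "\<forall>x\<in>S. \<forall>y\<in>S. x \<otimes>\<^bsub>int_lattice ?d\<^esub> y \<in> S"
  proof (intro ballI)
    fix s t assume "s \<in> S" "t \<in> S"
    then obtain x y where xy: "x \<in> carrier ?M" "s = \<phi> x" "y \<in> carrier ?M" "t = \<phi> y"
      unfolding S_def by blast
    then have "s \<otimes>\<^bsub>int_lattice ?d\<^esub> t = \<phi> (boxplus ?d x y)" by (simp only: hom)
    then show "s \<otimes>\<^bsub>int_lattice ?d\<^esub> t \<in> S" unfolding S_def using closed [OF xy(1,3)] by blast
  qed
  moreover have "?M \<cong> (int_lattice ?d)\<lparr>carrier := S\<rparr>"
  proof (rule is_isoI, rule isoI)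
    show "\<phi> \<in> hom ?M ((int_lattice ?d)\<lparr>carrier := S\<rparr>)"
      using hom by (intro homI) (auto simp: S_def simps(2))
    have "inj_on \<phi> (carrier ?M)"
    proof (rule inj_onI, rule ext)
      fix x y i assume x: "x \<in> carrier ?M" and y: "y \<in> carrier ?M" and eq: "\<phi> x = \<phi> y"
      show "x i = y i"
      proof (cases "i < ?d")
        case True
        then show ?thesis using fun_cong [OF eq, of i] by (simp add: \<phi>_def)
      next
        case False
        then show ?thesis using extensional [OF x] extensional [OF y] by (simp add: extensional_def)
      qed
    qed
    then show "bij_betw \<phi> (carrier ?M) (carrier ((int_lattice ?d)\<lparr>carrier := S\<rparr>))"
      by (simp add: bij_betw_def S_def)
  qed
  ultimately show ?thesis
    unfolding affine_monoid_def using mon by (intro conjI exI [of _ ?d] exI [of _ S])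
qed

theorem proposition5p3:
  assumes "DIM('a::euclidean_space) \<ge> 2"
  shows "affine_monoid (adapter_monoid TYPE('a)) \<and>
    (\<forall>(P::'a set) Q v F G w.
       adapter_polytope P \<and> adapter_polytope Q \<and> adapter_pair P v G \<and> adapter_pair Q w F \<longrightarrow>
         (\<exists>R. adapter_glueing P v Q F R) \<and>
         (\<forall>R. adapter_glueing P v Q F R \<longrightarrow>
            adapter_polytope R \<and>
            f_vector P \<otimes>\<^bsub>adapter_monoid TYPE('a)\<^esub> f_vector Q = f_vector R))"
proof (intro conjI allI impI, goal_cases)
  case 1
  show ?case by (rule affine_monoid_adapter_monoid)
next
  case (2 P Q v F G w)
  then show ?case using adapter_glueing_exists [of P v G Q w F] by simp
next
  case (3 P Q v F G w R)
  then show ?case using adapter_glueing_result(1) [of P v G Q w F R] by simp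
next
  case (4 P Q v F G w R)
  then show ?case using adapter_glueing_result(2) [of P v G Q w F R] by (simp add: mult_adapter_monoid)
qed

end
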